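(* Consider the bivariate normal missing data problem, with log-likelihood function $\ell(\mu,\Gamma)$ and score equations as given in the context. The ML-degree of this problem is equal to nine, i.e. for generic data the score equations $$\frac{\partial \ell}{\partial \mu_1}=\frac{\partial \ell}{\partial \mu_2}=\frac{\partial \ell}{\partial \gamma_{11}}=\frac{\partial \ell}{\partial \gamma_{22}}=\frac{\partial \ell}{\partial \gamma_{12}}=0$$ have exactly nine complex solutions $(\mu_1,\mu_2,\gamma_{11},\gamma_{12},\gamma_{22})$. For generic real sample data, at least one of these solutions is real. Moreover, at least one such real critical solution is a local maximum of $\ell$ in the statistically relevant parameter space $\mathbb{R}^2\times PD_2$, where $PD_2$ is the set of real symmetric positive definite $2\times 2$ matrices (i.e. $\mu=(\mu_1,\mu_2)\in\mathbb{R}^2$ and $\Gamma\in PD_2$).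
   Context: Let $(X_1,X_2)\sim\mathcal{N}(\mu,\Sigma)$ be bivariate normal with mean $\mu=(\mu_1,\mu_2)$ and covariance matrix $\Sigma$, and let $\Gamma=\Sigma^{-1}=\begin{pmatrix}\gamma_{11}&\gamma_{12}\\ \gamma_{12}&\gamma_{22}\end{pmatrix}$, so $\det\Gamma=\gamma_{11}\gamma_{22}-\gamma_{12}^2$. The data (missing at random) consist of $n$ complete observations $Y_j=(Y_{1,j},Y_{2,j})$ of $(X_1,X_2)$, $r$ observations $Z_j$ of $X_1$ only, and $s$ observations $W_j$ of $X_2$ only. A bar denotes a sample average: $\overline{Y_1},\overline{Y_2},\overline{Y_1^2},\overline{Y_1Y_2},\overline{Y_2^2}$ are averages over the $n$ complete observations, $\overline{Z},\overline{Z^2}$ over the $r$ observations $Z_j$, and $\overline{W},\overline{W^2}$ over the $s$ observations $W_j$. Up to an additive constant, the log-likelihood function is $$\ell(\mu,\Gamma)=\tfrac12(n+r+s)\log(\det\Gamma)-\tfrac12 r\log\gamma_{22}-\tfrac12 s\log\gamma_{11}$$ $$-\tfrac n2\Big[(\overline{Y_1^2}-2\mu_1\overline{Y_1}+\mu_1^2)\gamma_{11}+2(\overline{Y_1Y_2}-(\overline{Y_1}\mu_2+\overline{Y_2}\mu_1)+\mu_1\mu_2)\gamma_{12}+(\overline{Y_2^2}-2\mu_2\overline{Y_2}+\mu_2^2)\gamma_{22}\Big]$$ $$-\tfrac r2\,\frac{\det\Gamma}{\gamma_{22}}(\overline{Z^2}-2\mu_1\overline{Z}+\mu_1^2)-\tfrac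 s2\,\frac{\det\Gamma}{\gamma_{11}}(\overline{W^2}-2\mu_2\overline{W}+\mu_2^2).$$ The score (critical) equations are obtained by setting to zero the five partial derivatives of $\ell$ with respect to $\mu_1,\mu_2,\gamma_{11},\gamma_{22},\gamma_{12}$; these are rational functions of the parameters and of the twelve sufficient statistics $n,r,s,\overline{Y_1},\overline{Y_2},\overline{Y_1^2},\overline{Y_1Y_2},\overline{Y_2^2},\overline{Z},\overline{Z^2},\overline{W},\overline{W^2}$. Complex solutions are sought in $\mathbb{C}^5$ with all denominators $\gamma_{11},\gamma_{22},\det\Gamma$ nonzero. The number of complex solutions is the same for generic data; this number is called the maximum likelihood degree (ML-degree). "Generic" means that the vector of twelve sufficient statistics lies outside some proper algebraic subset of $\mathbb{C}^{12}$. "Real sample data" means that the statistics arise from actual real samples $Y_j\in\mathbb{R}^2$, $Z_j,W_j\in\mathbb{R}$ with positive integer sample sizes $n,r,s$. *)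

theory Defs
  imports "HOL-Analysis.Analysis"
begin

section \<open>Affine algebraic sets\<close>

text \<open>Points of the affine space over \<^typ>\<open>'k\<close> with coordinates indexed by \<^typ>\<open>'i\<close> are
  functions \<^typ>\<open>'i \<Rightarrow> 'k\<close>; it is only used for a twelve-element index type.\<close>

inductive polynomial_fun :: "(('i \<Rightarrow> 'k::comm_ring_1) \<Rightarrow> 'k) \<Rightarrow> bool" where
  const: "polynomial_fun (\<lambda>x. c)"
| coord: "polynomial_fun (\<lambda>x. x i)"
| add: "polynomial_fun f \<Longrightarrow> polynomial_fun g \<Longrightarrow> polynomial_fun (\<lambda>x. f x + g x)"
| mult: "polynomial_fun f \<Longrightarrow> polynomial_fun g \<Longrightarrow> polynomial_fun (\<lambda>x. f x * g x)"

definition algebraic_subset :: "('i \<Rightarrow> 'k::comm_ring_1) set \<Rightarrow> bool" where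
  "algebraic_subset V \<longleftrightarrow>
     (\<exists>F. (\<forall>f\<in>F. polynomial_fun f) \<and> V = {x. \<forall>f\<in>F. f x = 0})"

definition proper_algebraic_subset :: "('i \<Rightarrow> 'k::comm_ring_1) set \<Rightarrow> bool" where
  "proper_algebraic_subset V \<longleftrightarrow> algebraic_subset V \<and> V \<noteq> UNIV"


section \<open>Data\<close>

text \<open>The twelve sufficient statistics; \<open>Mean_YiYj\<close> is the average of the products
  \<open>Y\<^sub>i Y\<^sub>j\<close>, and \<open>Mean_ZZ\<close>, \<open>Mean_WW\<close> are the averages of the squares.\<close>

datatype stat =
    Size_n | Size_r | Size_s
  | Mean_Y1 | Mean_Y2 | Mean_Y1Y1 | Mean_Y1Y2 | Mean_Y2Y2
  | Mean_Z | Mean_ZZ | Mean_W | Mean_WW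

definition average :: "nat \<Rightarrow> (nat \<Rightarrow> real) \<Rightarrow> real" where
  "average m x = (\<Sum>j=1..m. x j) / real m"

fun sample_stats ::
  "nat \<Rightarrow> nat \<Rightarrow> nat \<Rightarrow> (nat \<Rightarrow> real \<times> real) \<Rightarrow> (nat \<Rightarrow> real) \<Rightarrow> (nat \<Rightarrow> real) \<Rightarrow> stat \<Rightarrow> real"
where
  "sample_stats n r s Y Z W Size_n = real n"
| "sample_stats n r s Y Z W Size_r = real r"
| "sample_stats n r s Y Z W Size_s = real s"
| "sample_stats n r s Y Z W Mean_Y1 = average n (\<lambda>j. fst (Y j))"
| "sample_stats n r s Y Z W Mean_Y2 = average n (\<lambda>j. snd (Y j))"
| "sample_stats n r s Y Z W Mean_Y1Y1 = average n (\<lambda>j. (fst (Y j))\<^sup>2)"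
| "sample_stats n r s Y Z W Mean_Y1Y2 = average n (\<lambda>j. fst (Y j) * snd (Y j))"
| "sample_stats n r s Y Z W Mean_Y2Y2 = average n (\<lambda>j. (snd (Y j))\<^sup>2)"
| "sample_stats n r s Y Z W Mean_Z = average r Z"
| "sample_stats n r s Y Z W Mean_ZZ = average r (\<lambda>j. (Z j)\<^sup>2)"
| "sample_stats n r s Y Z W Mean_W = average s W"
| "sample_stats n r s Y Z W Mean_WW = average s (\<lambda>j. (W j)\<^sup>2)"

definition real_sample_data :: "(stat \<Rightarrow> real) set" where
  "real_sample_data =
     {sample_stats n r s Y Z W | n r s Y Z W. n > 0 \<and> r > 0 \<and> s > 0}"


section \<open>The log-likelihood function\<close>

text \<open>A parameter is a tuple \<open>(\<mu>\<^sub>1, \<mu>\<^sub>2, \<gamma>\<^sub>1\<^sub>1, \<gamma>\<^sub>1\<^sub>2, \<gamma>\<^sub>2\<^sub>2)\<close>.\<close>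

type_synonym 'a param = "'a \<times> 'a \<times> 'a \<times> 'a \<times> 'a"

definition conc_matrix :: "'a \<Rightarrow> 'a \<Rightarrow> 'a \<Rightarrow> 'a::zero^2^2" where
  "conc_matrix g11 g12 g22 = vector [vector [g11, g12], vector [g12, g22]]"

text \<open>The logarithm \<open>lg\<close> is a parameter: it is \<^const>\<open>ln\<close> over the reals and a local
  holomorphic branch of the logarithm over the complex numbers.\<close>

fun loglik :: "('a \<Rightarrow> 'a) \<Rightarrow> (stat \<Rightarrow> 'a) \<Rightarrow> 'a param \<Rightarrow> 'a::field" where
  "loglik lg d (m1, m2, g11, g12, g22) =
     (let n = d Size_n; r = d Size_r; s = d Size_s; D = det (conc_matrix g11 g12 g22) in
        1/2 * (n + r + s) * lg D - 1/2 * r * lg g22 - 1/2 * s * lg g11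
        - n/2 * ((d Mean_Y1Y1 - 2 * m1 * d Mean_Y1 + m1\<^sup>2) * g11
               + 2 * (d Mean_Y1Y2 - (d Mean_Y1 * m2 + d Mean_Y2 * m1) + m1 * m2) * g12
               + (d Mean_Y2Y2 - 2 * m2 * d Mean_Y2 + m2\<^sup>2) * g22)
        - r/2 * (D / g22) * (d Mean_ZZ - 2 * m1 * d Mean_Z + m1\<^sup>2)
        - s/2 * (D / g11) * (d Mean_WW - 2 * m2 * d Mean_W + m2\<^sup>2))"


section \<open>Score equations\<close>

definition log_branch :: "complex set \<Rightarrow> (complex \<Rightarrow> complex) \<Rightarrow> bool" where
  "log_branch U L \<longleftrightarrow> open U \<and> L holomorphic_on U \<and> (\<forall>z\<in>U. exp (L z) = z)"

text \<open>Two branches of the logarithm differ by a locally constant function, so the partial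
  derivatives of the log-likelihood do not depend on the branch \<open>L\<close>.  A branch defined near
  all three of \<open>\<gamma>\<^sub>1\<^sub>1\<close>, \<open>\<gamma>\<^sub>2\<^sub>2\<close>, \<open>det \<Gamma>\<close> always exists when these are nonzero; using the
  principal branch \<^const>\<open>Ln\<close> instead would lose the solutions on its cut.\<close>

fun score_solution :: "(stat \<Rightarrow> complex) \<Rightarrow> complex param \<Rightarrow> bool" where
  "score_solution d (m1, m2, g11, g12, g22) \<longleftrightarrow>
     g11 \<noteq> 0 \<and> g22 \<noteq> 0 \<and> det (conc_matrix g11 g12 g22) \<noteq> 0 \<and>
     (\<exists>U L. log_branch U L \<and> {g11, g22, det (conc_matrix g11 g12 g22)} \<subseteq> U \<and>
        ((\<lambda>t. loglik L d (t, m2, g11, g12, g22)) has_field_derivative 0) (at m1) \<and>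
        ((\<lambda>t. loglik L d (m1, t, g11, g12, g22)) has_field_derivative 0) (at m2) \<and>
        ((\<lambda>t. loglik L d (m1, m2, t, g12, g22)) has_field_derivative 0) (at g11) \<and>
        ((\<lambda>t. loglik L d (m1, m2, g11, g12, t)) has_field_derivative 0) (at g22) \<and>
        ((\<lambda>t. loglik L d (m1, m2, g11, t, g22)) has_field_derivative 0) (at g12))"

definition complex_stats :: "(stat \<Rightarrow> real) \<Rightarrow> stat \<Rightarrow> complex" where
  "complex_stats d = (\<lambda>i. complex_of_real (d i))"

fun complex_param :: "real param \<Rightarrow> complex param" where
  "complex_param (m1, m2, g11, g12, g22) =
     (complex_of_real m1, complex_of_real m2,
      complex_of_real g11, complex_of_real g12, complex_of_real g22)"


section \<open>The statistically relevant parameter space\<close>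

definition PD :: "(real^2^2) set" where
  "PD = {A. transpose A = A \<and> (\<forall>x. x \<noteq> 0 \<longrightarrow> x \<bullet> (A *v x) > 0)}"

definition param_space :: "real param set" where
  "param_space = {(m1, m2, g11, g12, g22). conc_matrix g11 g12 g22 \<in> PD}"

definition local_max_on ::
  "('a::topological_space \<Rightarrow> real) \<Rightarrow> 'a set \<Rightarrow> 'a \<Rightarrow> bool" where
  "local_max_on f S x \<longleftrightarrow> x \<in> S \<and> (\<forall>\<^sub>F y in at x within S. f y \<le> f x)"

end

theory Submission
  imports Defs
    "Jordan_Normal_Form.Determinant"
    "HOL-Computational_Algebra.Fundamental_Theorem_Algebra"
begin

text \<open>Why there are nine critical points.  Let \<open>p = - \<gamma>\<^sub>1\<^sub>2/\<gamma>\<^sub>2\<^sub>2\<close> and \<open>q = - \<gamma>\<^sub>1\<^sub>2/\<gamma>\<^sub>1\<^sub>1\<close> be the two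
  regression slopes, \<open>w = - \<gamma>\<^sub>1\<^sub>2/det \<Gamma>\<close> the covariance, and \<open>k = 1 - p q\<close>, which is one minus the
  squared correlation.  Let \<open>c1\<close> be the difference of the sample means of \<open>Z\<close> and \<open>Y\<^sub>1\<close>, let \<open>c2\<close>
  be that of \<open>W\<close> and \<open>Y\<^sub>2\<close>, and write the means as \<open>\<mu>\<^sub>1 = Z - n c1 \<xi>\<close> and
  \<open>\<mu>\<^sub>2 = W - n c2 \<eta>\<close>, where \<open>Z\<close> and \<open>W\<close> stand for the sample means.  The equations for \<open>\<Gamma>\<close>
  are linear in \<open>w\<close>.  The equations for \<open>\<mu>\<close> express \<open>q\<close> and \<open>p\<close> affinely through \<open>\<xi>\<close> and \<open>\<eta>\<close>,
  with coefficients depending on \<open>k\<close>.  After eliminating \<open>w\<close>, \<open>p\<close> and \<open>q\<close>, the system consists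
  of three equations that are linear in \<open>\<xi>\<close>, \<open>\<eta>\<close> and \<open>\<zeta> = \<xi> \<eta>\<close>, with coefficients polynomial in
  \<open>k\<close> (\<open>reduced_score_iff\<close>).  Cramer's rule gives \<open>\<xi>\<close>, \<open>\<eta>\<close>, \<open>\<zeta>\<close> as quotients of polynomials of
  degree at most 4 by a common denominator of degree at most 5, and \<open>\<zeta> = \<xi> \<eta>\<close> becomes one
  polynomial equation for \<open>k\<close> of degree at most 4 + 5 = 9, the eliminant.  For generic data its roots
  correspond to the critical points (\<open>score_solutions_bij_roots\<close>).

  Why the nine roots are distinct and usable.  The eliminant must not share a root with its derivative,
  with the Cramer denominator, or with the numerator of \<open>w\<close>.  Each such condition is the nonvanishing
  of a Sylvester determinant, which is polynomial in the data (\<open>generic_no_common_root\<close>).  That these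
  determinants do not vanish identically is seen at one explicit point, by Bezout identities
  (\<open>sample_point_bezout\<close>).

  Why a real local maximum exists.  If the sample covariance matrix is positive definite and the sample
  variances of \<open>Z\<close> and \<open>W\<close> are positive, the log-likelihood tends to minus infinity at the boundary of
  the parameter space (\<open>loglik_superlevel_bounded\<close>).  It therefore attains its maximum in this open
  set, and the maximiser is a real solution of the score equations.\<close>

section \<open>Polynomial families and generic coprimality\<close>

lemma polynomial_fun_minus:
  assumes "polynomial_fun f" "polynomial_fun g"
  shows "polynomial_fun (\<lambda>d. f d - g d)"
  using polynomial_fun.add[OF assms(1) polynomial_fun.mult[OF polynomial_fun.const[of "-1"] assms(2)]]
  by simp

lemma polynomial_fun_uminus: "polynomial_fun f \<Longrightarrow> polynomial_fun (\<lambda>d. - f d)"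
  using polynomial_fun_minus[OF polynomial_fun.const[of 0]] by simp

lemma polynomial_fun_power: "polynomial_fun f \<Longrightarrow> polynomial_fun (\<lambda>d. f d ^ k)"
  by (induction k) (auto intro: polynomial_fun.intros)

lemma polynomial_fun_sum:
  "(\<And>i. i \<in> I \<Longrightarrow> polynomial_fun (f i)) \<Longrightarrow> polynomial_fun (\<lambda>d. \<Sum>i\<in>I. f i d)"
  by (induction I rule: infinite_finite_induct) (auto intro: polynomial_fun.intros)

lemma polynomial_fun_prod:
  "(\<And>i. i \<in> I \<Longrightarrow> polynomial_fun (f i)) \<Longrightarrow> polynomial_fun (\<lambda>d. \<Prod>i\<in>I. f i d)"
  by (induction I rule: infinite_finite_induct) (auto intro: polynomial_fun.intros)

text \<open>Univariate polynomials whose coefficients depend polynomially on a point of affine space.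
  The uniform degree bound fixes the size of the matrix built from such a family below.\<close>
definition poly_family :: "nat \<Rightarrow> (('i \<Rightarrow> 'k::comm_ring_1) \<Rightarrow> 'k poly) \<Rightarrow> bool" where
  "poly_family m F \<longleftrightarrow>
     (\<forall>d. degree (F d) \<le> m) \<and> (\<forall>i. polynomial_fun (\<lambda>d. coeff (F d) i))"

lemma poly_family_mono: "poly_family m F \<Longrightarrow> m \<le> m' \<Longrightarrow> poly_family m' F"
  unfolding poly_family_def using order_trans by blast

lemma poly_family_const: "polynomial_fun f \<Longrightarrow> poly_family 0 (\<lambda>d. [:f d:])"
  unfolding poly_family_def
proof (intro conjI allI)
  show "polynomial_fun (\<lambda>d. coeff [:f d:] i)" if "polynomial_fun f" for i
    using that by (cases "i = 0") (auto simp: coeff_pCons' intro: polynomial_fun.const)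
qed simp

lemma poly_family_var: "poly_family 1 (\<lambda>d. [:0, 1:])"
  unfolding poly_family_def by (auto simp: coeff_pCons' intro: polynomial_fun.const)

lemma poly_family_add:
  assumes "poly_family m F" "poly_family n G"
  shows "poly_family (max m n) (\<lambda>d. F d + G d)"
  using assms unfolding poly_family_def
  by (auto intro!: polynomial_fun.add degree_add_le intro: max.coboundedI1 max.coboundedI2)

lemma poly_family_minus:
  assumes "poly_family m F" "poly_family n G"
  shows "poly_family (max m n) (\<lambda>d. F d - G d)"
  using assms unfolding poly_family_def
  by (auto intro!: polynomial_fun_minus degree_diff_le intro: max.coboundedI1 max.coboundedI2)

lemma poly_family_uminus: "poly_family m F \<Longrightarrow> poly_family m (\<lambda>d. - F d)"
  unfolding poly_family_def by (auto intro: polynomial_fun_uminus)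

lemma poly_family_mult:
  assumes "poly_family m F" "poly_family n G"
  shows "poly_family (m + n) (\<lambda>d. F d * G d)"
  using assms unfolding poly_family_def coeff_mult
  by (auto intro!: polynomial_fun_sum polynomial_fun.mult order_trans[OF degree_mult_le] add_mono)

lemma poly_family_power: "poly_family m F \<Longrightarrow> poly_family (m * k) (\<lambda>d. F d ^ k)"
proof (induction k)
  case 0
  show ?case using poly_family_const[OF polynomial_fun.const[of 1]] by (simp add: pCons_one)
next
  case (Suc k)
  then show ?case using poly_family_mult by fastforce
qed

lemma poly_family_pderiv:
  fixes F :: "('i \<Rightarrow> 'k::{comm_ring_1,ring_no_zero_divisors,ring_char_0}) \<Rightarrow> 'k poly"
  assumes "poly_family m F"
  shows "poly_family (m - 1) (\<lambda>d. pderiv (F d))"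
  using assms unfolding poly_family_def
  by (auto simp: degree_pderiv coeff_pderiv intro!: polynomial_fun.mult polynomial_fun.const
      intro: diff_le_mono simp del: of_nat_Suc)

text \<open>Coprimality at one point spreads to a Zariski-open set.  The polynomial \<open>\<rho>\<close> is the
  determinant of a Sylvester matrix whose rows are the coefficients of \<open>z\<^sup>i F\<close> for \<open>i < n\<close> and
  \<open>z\<^sup>i G\<close> for \<open>i < m\<close>.  A common root \<open>z\<close> puts the vector of powers of \<open>z\<close> into its kernel.
  A vector in the left kernel at \<open>d0\<close> is a relation \<open>a F + b G = 0\<close> with \<open>deg a < n\<close> and
  \<open>deg b < m\<close>; by the Bezout identity \<open>F\<close> divides \<open>b\<close>, so that \<open>b = 0\<close> and then \<open>a = 0\<close>.
  Using the degree bounds \<open>m\<close> and \<open>n\<close> instead of the actual degrees keeps the size of the matrix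
  independent of \<open>d\<close>; only \<open>F\<close>, and only at \<open>d0\<close>, has to reach its bound.\<close>
lemma generic_no_common_root:
  fixes F G :: "('i \<Rightarrow> 'k::field) \<Rightarrow> 'k poly"
  assumes F: "poly_family m F" and G: "poly_family n G"
    and deg: "degree (F d0) = m"
    and bezout: "u * F d0 + v * G d0 = [:c:]" "c \<noteq> 0"
    and pos: "m > 0"
  obtains \<rho> where "polynomial_fun \<rho>" "\<rho> d0 \<noteq> 0"
    "\<And>d z. \<rho> d \<noteq> 0 \<Longrightarrow> poly (F d) z = 0 \<Longrightarrow> poly (G d) z \<noteq> 0"
proof -
  define N where "N = m + n"
  define R where "R d i = (if i < n then monom 1 i * F d else monom 1 (i - n) * G d)" for d i
  define M where "M d = mat N N (\<lambda>(i, j). coeff (R d i) j)" for d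
  have M [simp]: "M d \<in> carrier_mat N N" for d by (simp add: M_def)
  have degR: "degree (R d i) < N" if "i < N" for d i
  proof -
    have "degree (F d) \<le> m" "degree (G d) \<le> n"
      using F G unfolding poly_family_def by auto
    then have "i < n \<Longrightarrow> degree (monom (1::'k) i * F d) \<le> i + m"
      "degree (monom (1::'k) (i - n) * G d) \<le> (i - n) + n"
      by (metis add_mono degree_monom_le degree_mult_le order_trans)+
    then show ?thesis using that unfolding R_def N_def by auto
  qed
  have coeffs_poly: "polynomial_fun (\<lambda>d. coeff (R d i) j)" for i j
    using F G unfolding R_def poly_family_def
    by (cases "i < n"; cases "i \<le> j"; cases "i - n \<le> j")
       (auto simp: coeff_monom_mult intro: polynomial_fun.const)
  have "polynomial_fun (\<lambda>d. Determinant.det (M d))"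
  proof -
    have eq: "Determinant.det (M d) =
        (\<Sum>p | p permutes {0..<N}. signof p * (\<Prod>i = 0..<N. coeff (R d i) (p i)))" for d
      unfolding det_def'[OF M]
      by (intro sum.cong prod.cong arg_cong2[where f = "(*)"])
         (auto simp: M_def permutes_in_image[where S = "{0..<N}", simplified])
    show ?thesis unfolding eq
      by (intro polynomial_fun_sum polynomial_fun.mult polynomial_fun_prod polynomial_fun.const coeffs_poly)
  qed
  moreover have "Determinant.det (M d0) \<noteq> 0"
  proof
    assume "Determinant.det (M d0) = 0"
    then have "Determinant.det (transpose_mat (M d0)) = 0" by (simp add: det_transpose[OF M])
    then obtain x where x: "x \<in> carrier_vec N" "x \<noteq> 0\<^sub>v N" "transpose_mat (M d0) *\<^sub>v x = 0\<^sub>v N"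
      using det_0_iff_vec_prod_zero_field[of "transpose_mat (M d0)" N] by auto
    define a where "a = (\<Sum>i<n. monom (vec_index x i) i)"
    define b where "b = (\<Sum>i<m. monom (vec_index x (n + i)) i)"
    have split: "sum g {..<n + m} = sum g {..<n} + (\<Sum>i<m. g (n + i))" for g :: "nat \<Rightarrow> 'k poly"
      by (induction m) (simp_all add: ac_simps)
    have monom_mult: "monom e i * p = Polynomial.smult e (monom 1 i * p)" for e :: 'k and i p
      by (simp add: smult_monom flip: mult_smult_left)
    have "a * F d0 + b * G d0 = (\<Sum>i<N. Polynomial.smult (vec_index x i) (R d0 i))"
    proof -
      have "(\<Sum>i<N. Polynomial.smult (vec_index x i) (R d0 i)) =
          (\<Sum>i<n. Polynomial.smult (vec_index x i) (R d0 i)) + (\<Sum>i<m. Polynomial.smult (vec_index x (n + i)) (R d0 (n + i)))"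
        unfolding N_def by (subst add.commute) (rule split)
      also have "\<dots> = a * F d0 + b * G d0"
        by (simp add: R_def a_def b_def sum_distrib_right monom_mult[of "vec_index x _"])
      finally show ?thesis by simp
    qed
    also have "\<dots> = 0"
    proof (rule poly_eqI)
      fix j
      show "coeff (\<Sum>i<N. Polynomial.smult (vec_index x i) (R d0 i)) j = coeff 0 j"
      proof (cases "j < N")
        case True
        have "0 = vec_index (transpose_mat (M d0) *\<^sub>v x) j" using x True by simp
        also have "\<dots> = (\<Sum>i<N. coeff (R d0 i) j * vec_index x i)"
          using x(1) True by (simp add: M_def scalar_prod_def lessThan_atLeast0)
        finally show ?thesis by (simp add: coeff_sum mult.commute)
      next
        case False
        then have "coeff (R d0 i) j = 0" if "i < N" for i
          using degR[OF that, of d0] by (simp add: coeff_eq_0)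
        then show ?thesis by (simp add: coeff_sum)
      qed
    qed
    finally have zero: "a * F d0 + b * G d0 = 0" .
    have "Polynomial.smult c b = F d0 * (u * b - v * a)"
    proof -
      have "Polynomial.smult c b = (u * F d0 + v * G d0) * b" unfolding bezout by simp
      also have "\<dots> = F d0 * (u * b - v * a) + v * (a * F d0 + b * G d0)" by (simp add: algebra_simps)
      finally show ?thesis by (simp add: zero)
    qed
    then have "F d0 dvd b" using bezout(2) by (metis dvd_smult_cancel dvd_triv_left)
    moreover have "b = 0 \<or> degree b < m"
    proof (cases "m = 0")
      case False
      have "degree b \<le> m - 1" unfolding b_def
        by (intro degree_sum_le) (auto intro: order_trans[OF degree_monom_le])
      then show ?thesis using False by auto
    qed (simp add: b_def)
    ultimately have b0: "b = 0" using deg dvd_imp_degree_le[of "F d0" b] by linarith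
    have "F d0 \<noteq> 0" using deg pos by auto
    then have a0: "a = 0" using zero b0 by simp
    have "vec_index x i = 0" if "i < N" for i
    proof (cases "i < n")
      case True
      have "coeff a i = vec_index x i" using True by (simp add: a_def coeff_sum)
      then show ?thesis using a0 by simp
    next
      case False
      then have "coeff b (i - n) = vec_index x i"
        using that by (simp add: b_def coeff_sum N_def)
      then show ?thesis using b0 by simp
    qed
    then show False using x by auto
  qed
  moreover have "poly (G d) z \<noteq> 0" if "Determinant.det (M d) \<noteq> 0" "poly (F d) z = 0" for d z
  proof
    assume "poly (G d) z = 0"
    define y where "y = vec N (\<lambda>j. z ^ j)"
    have root: "poly (R d i) z = 0" for i using that \<open>poly (G d) z = 0\<close> by (simp add: R_def)
    have "M d *\<^sub>v y = 0\<^sub>v N"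
    proof (rule eq_vecI)
      fix i assume "i < dim_vec (0\<^sub>v N :: 'k vec)"
      then have i: "i < N" by simp
      have "vec_index (M d *\<^sub>v y) i = (\<Sum>j<N. coeff (R d i) j * z ^ j)"
        using i by (simp add: M_def y_def scalar_prod_def lessThan_atLeast0)
      also have "\<dots> = (\<Sum>j\<le>degree (R d i). coeff (R d i) j * z ^ j)"
        using degR[OF i, of d] by (intro sum.mono_neutral_right) (auto simp: coeff_eq_0)
      also have "\<dots> = 0" using root[of i] by (simp add: poly_altdef)
      finally show "vec_index (M d *\<^sub>v y) i = vec_index (0\<^sub>v N) i" using i by simp
    qed (simp add: M_def)
    moreover have "y \<noteq> 0\<^sub>v N"
    proof
      assume "y = 0\<^sub>v N"
      then have "vec_index y 0 = vec_index (0\<^sub>v N) 0" by simp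
      then show False using pos by (simp add: y_def N_def)
    qed
    moreover have "y \<in> carrier_vec N" by (simp add: y_def)
    ultimately show False
      using det_0_iff_vec_prod_zero_field[OF M, of d] that(1) by blast
  qed
  ultimately show ?thesis using that by blast
qed

section \<open>Eliminating the covariance and the regression slopes\<close>

text \<open>The determinant of the linear system for the two means, written in the coordinate
  \<open>k = 1 - p q\<close>: it equals \<open>(n + r) (n + s) - r s p q\<close>.\<close>
definition mean_det :: "'a::comm_ring_1 \<Rightarrow> 'a \<Rightarrow> 'a \<Rightarrow> 'a \<Rightarrow> 'a" where
  "mean_det n r s k = n * (n + r + s) + r * s * k"

text \<open>The coefficients of one equation of the linear system in \<open>\<xi>\<close>, \<open>\<eta>\<close>, \<open>\<zeta> = \<xi> \<eta>\<close> that is left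
  after eliminating the covariance \<open>w\<close>.  The other equation is obtained by exchanging the roles of
  the two variables, that is \<open>r\<close> with \<open>s\<close>, \<open>c1\<close> with \<open>c2\<close>, \<open>v11\<close> with \<open>v22\<close> and \<open>W\<close> with \<open>Z\<close>;
  hence the coefficients are stated for arbitrary ring elements.\<close>
definition row_own :: "'a::comm_ring_1 \<Rightarrow> 'a \<Rightarrow> 'a \<Rightarrow> 'a \<Rightarrow> 'a \<Rightarrow> 'a \<Rightarrow> 'a \<Rightarrow> 'a \<Rightarrow> 'a" where
  "row_own n r s c1 c2 v22 W k =
     - (r * c1\<^sup>2 * (mean_det n r s k * (k * W - v22) + n * (n + r) * c2\<^sup>2 * k))"

definition row_cross :: "'a::comm_ring_1 \<Rightarrow> 'a \<Rightarrow> 'a \<Rightarrow> 'a \<Rightarrow> 'a \<Rightarrow> 'a \<Rightarrow> 'a" where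
  "row_cross n r s c2 v11 k = (n + s) * c2\<^sup>2 * v11 * mean_det n r s k"

definition row_prod :: "'a::comm_ring_1 \<Rightarrow> 'a \<Rightarrow> 'a \<Rightarrow> 'a \<Rightarrow> 'a \<Rightarrow> 'a \<Rightarrow> 'a" where
  "row_prod n r s c1 c2 k = r\<^sup>2 * s * (n + s) * c1\<^sup>2 * c2\<^sup>2 * k\<^sup>2"

definition row_rhs ::
  "'a::comm_ring_1 \<Rightarrow> 'a \<Rightarrow> 'a \<Rightarrow> 'a \<Rightarrow> 'a \<Rightarrow> 'a \<Rightarrow> 'a \<Rightarrow> 'a \<Rightarrow> 'a \<Rightarrow> 'a \<Rightarrow> 'a" where
  "row_rhs n r s c1 c2 v11 v12 v22 W k =
     (n + s) * (n + r) * c2\<^sup>2 * v11 - r * (n + s) * c1\<^sup>2 * (k * W - v22)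
     - r * c1 * c2 * (k * (n * c1 * c2 - s * v12) + (n + 2 * s) * v12)"

text \<open>The score equations for the means are bilinear in the slopes \<open>p\<close>, \<open>q\<close> and the deviations
  \<open>n c1 \<xi>\<close>, \<open>n c2 \<eta>\<close> of the means.  Elimination expresses each mean_det through one deviation and
  \<open>k\<close>; substituting back leaves an equation in which \<open>\<xi>\<close> and \<open>\<eta>\<close> occur only linearly and in
  the product \<open>\<xi> \<eta>\<close>.\<close>
lemma mean_eqs_fwd:
  fixes n r s c1 c2 p q k \<xi> \<eta> :: "'a::field"
  assumes nz: "n \<noteq> 0" "c1 \<noteq> 0" "c2 \<noteq> 0" and k: "k = 1 - p * q"
    and P1: "(n + r) * (n * c1 * \<xi>) + s * q * (n * c2 * \<eta>) = n * c1"
    and P2: "r * p * (n * c1 * \<xi>) + (n + s) * (n * c2 * \<eta>) = n * c2"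
  shows "s * c2 * q = c1 * (n + s - mean_det n r s k * \<xi>)"
    and "r * c1 * p = c2 * (n + r - mean_det n r s k * \<eta>)"
    and "(n + r) * \<xi> + (n + s) * \<eta> - mean_det n r s k * (\<xi> * \<eta>) = 1"
proof -
  have "n * (s * c2 * q - c1 * (n + s - mean_det n r s k * \<xi>)) =
      (n + s) * ((n + r) * (n * c1 * \<xi>) + s * q * (n * c2 * \<eta>) - n * c1)
      - s * q * (r * p * (n * c1 * \<xi>) + (n + s) * (n * c2 * \<eta>) - n * c2)"
    unfolding mean_det_def k by (simp add: algebra_simps power2_eq_square)
  then show q: "s * c2 * q = c1 * (n + s - mean_det n r s k * \<xi>)" using nz P1 P2 by simp
  have "n * (r * c1 * p - c2 * (n + r - mean_det n r s k * \<eta>)) =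
      (n + r) * (r * p * (n * c1 * \<xi>) + (n + s) * (n * c2 * \<eta>) - n * c2)
      - r * p * ((n + r) * (n * c1 * \<xi>) + s * q * (n * c2 * \<eta>) - n * c1)"
    unfolding mean_det_def k by (simp add: algebra_simps power2_eq_square)
  then show "r * c1 * p = c2 * (n + r - mean_det n r s k * \<eta>)" using nz P1 P2 by simp
  have "n * c1 * ((n + r) * \<xi> + (n + s) * \<eta> - mean_det n r s k * (\<xi> * \<eta>) - 1) =
      (n + r) * (n * c1 * \<xi>) + s * q * (n * c2 * \<eta>) - n * c1
      - n * \<eta> * (s * c2 * q - c1 * (n + s - mean_det n r s k * \<xi>))"
    by (simp add: algebra_simps power2_eq_square)
  then show "(n + r) * \<xi> + (n + s) * \<eta> - mean_det n r s k * (\<xi> * \<eta>) = 1"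
    using nz P1 q by simp
qed

text \<open>The converse recovers \<open>p q = 1 - k\<close> as well: multiplying the expressions for the two slopes
  gives \<open>p q - (1 - k)\<close> as a multiple of the third equation.  The determinant of the mean equations
  is never inverted, so it may vanish.\<close>
lemma mean_eqs_bwd:
  fixes n r s c1 c2 p q k \<xi> \<eta> :: "'a::field"
  assumes nz: "r \<noteq> 0" "s \<noteq> 0" "c1 \<noteq> 0" "c2 \<noteq> 0"
    and q: "s * c2 * q = c1 * (n + s - mean_det n r s k * \<xi>)"
    and p: "r * c1 * p = c2 * (n + r - mean_det n r s k * \<eta>)"
    and H: "(n + r) * \<xi> + (n + s) * \<eta> - mean_det n r s k * (\<xi> * \<eta>) = 1"
  shows "p * q = 1 - k"
    and "(n + r) * (n * c1 * \<xi>) + s * q * (n * c2 * \<eta>) = n * c1"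
    and "r * p * (n * c1 * \<xi>) + (n + s) * (n * c2 * \<eta>) = n * c2"
proof -
  have "(r * c1 * p) * (s * c2 * q) - r * s * c1 * c2 * (1 - k) =
     c1 * c2 * (mean_det n r s k) * (1 - ((n + r) * \<xi> + (n + s) * \<eta> - mean_det n r s k * (\<xi> * \<eta>)))"
    unfolding p q unfolding mean_det_def by (simp add: algebra_simps power2_eq_square)
  then have "r * s * c1 * c2 * (p * q - (1 - k)) = 0"
    unfolding H by (simp add: algebra_simps)
  then show "p * q = 1 - k" using nz by simp
  have "(n + r) * (n * c1 * \<xi>) + s * q * (n * c2 * \<eta>) - n * c1 =
      n * c1 * ((n + r) * \<xi> + (n + s) * \<eta> - mean_det n r s k * (\<xi> * \<eta>) - 1)
      + n * \<eta> * (s * c2 * q - c1 * (n + s - mean_det n r s k * \<xi>))"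
    by (simp add: algebra_simps power2_eq_square)
  then show "(n + r) * (n * c1 * \<xi>) + s * q * (n * c2 * \<eta>) = n * c1" using H q by simp
  have "r * p * (n * c1 * \<xi>) + (n + s) * (n * c2 * \<eta>) - n * c2 =
      n * c2 * ((n + r) * \<xi> + (n + s) * \<eta> - mean_det n r s k * (\<xi> * \<eta>) - 1)
      + n * \<xi> * (r * c1 * p - c2 * (n + r - mean_det n r s k * \<eta>))"
    by (simp add: algebra_simps power2_eq_square)
  then show "r * p * (n * c1 * \<xi>) + (n + s) * (n * c2 * \<eta>) = n * c2" using H p by simp
qed

lemma mean_det_commute: "mean_det n s r k = mean_det n r s k"
  by (simp add: mean_det_def algebra_simps)

text \<open>The first exchange in the elimination of \<open>w\<close>: the difference of the equation for \<open>\<gamma>\<^sub>1\<^sub>2\<close> and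
  the one for \<open>\<gamma>\<^sub>1\<^sub>1\<close> (here \<open>g3\<close> and \<open>g1\<close>).  The mean equations \<open>h1\<close>, \<open>h2\<close> turn the quadratic
  terms in the deviations into \<open>q y\<close> and \<open>x y\<close>, and every remaining term with \<open>w\<close> carries
  the factor \<open>k\<close>.\<close>
lemma diff_exchange:
  fixes n s c2 v11 v12 W p q w x y k e f U T g1 g2 r S11 S12 :: "'a::field"
  assumes k: "k = 1 - p * q"
    and h1: "s * y * k = n * (p * e - f)"
    and h2: "r * x * k = n * (q * f - e)"
    and f: "f = y - c2"
    and S11: "S11 = v11 + e\<^sup>2" and S12: "S12 = v12 + e * f" and U: "U = W + y\<^sup>2"
    and g3: "g3 = n * S12 + r * p * T + s * q * U - w * (n + r + s)"
    and g1: "g1 = p * (n * S11 + r * T + s * q\<^sup>2 * U) - w * (n + r + s * (p * q))"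
  shows "n * (g3 - g1) = n\<^sup>2 * (v12 - p * v11)
     + s * k * (n * q * W + n * q * c2 * y + r * k * x * y) - n * s * k * w"
proof -
  have "g3 - g1 = n * (v12 - p * v11) - e * (n * (p * e - f)) + s * k * q * U - s * k * w"
    unfolding g3 g1 S11 S12 k by (simp add: algebra_simps power2_eq_square)
  also have "\<dots> = n * (v12 - p * v11) + s * k * (q * U - e * y) - s * k * w"
    unfolding h1[symmetric] by (simp add: algebra_simps)
  finally have "n * (g3 - g1) = n * (n * (v12 - p * v11) + s * k * (q * U - e * y) - s * k * w)"
    by simp
  also have "\<dots> =
      n\<^sup>2 * (v12 - p * v11) + s * k * (n * (q * U - e * y)) - n * s * k * w"
    by (simp add: algebra_simps power2_eq_square)
  also have "n * (q * U - e * y) = n * q * W + n * q * c2 * y + (n * (q * f - e)) * y"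
    unfolding U f by (simp add: algebra_simps power2_eq_square)
  also have "\<dots> = n * q * W + n * q * c2 * y + r * k * x * y"
    unfolding h2[symmetric] by (simp add: algebra_simps)
  finally show ?thesis .
qed

text \<open>The mean equations make the equation for \<open>\<gamma>\<^sub>1\<^sub>2\<close> free of squares of the deviations: the
  squares combine with the cross product \<open>e f\<close> into a multiple of \<open>k x y\<close>.\<close>
lemma cross_moment:
  fixes n r s c1 c2 v12 Z W p q w x y k e f U T g3 S12 :: "'a::field"
  assumes P2: "n * f = - (r * p * x + s * y)"
    and h2: "r * x * k = n * (q * f - e)"
    and e: "e = x - c1" and f: "f = y - c2"
    and S12: "S12 = v12 + e * f" and T: "T = Z + x\<^sup>2" and U: "U = W + y\<^sup>2"
    and g3: "g3 = n * S12 + r * p * T + s * q * U - w * (n + r + s)"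
  shows "n * g3 = n\<^sup>2 * v12 + r * n * p * (Z + c1 * x) + s * n * q * (W + c2 * y)
    + r * s * k * x * y - n * w * (n + r + s)"
proof -
  have "n * g3 - (n\<^sup>2 * v12 + r * n * p * (Z + c1 * x) + s * n * q * (W + c2 * y)
         - n * w * (n + r + s)) = n * e * (n * f + r * p * x) + n * s * q * y * f"
    unfolding g3 S12 T U e f by (simp add: algebra_simps power2_eq_square)
  also have "\<dots> = s * y * (n * (q * f - e))"
    unfolding P2 by (simp add: algebra_simps)
  also have "\<dots> = r * s * k * x * y" unfolding h2[symmetric] by simp
  finally show ?thesis by (simp add: algebra_simps)
qed

text \<open>Eliminating \<open>w\<close> between \<open>GA = 0\<close> and \<open>GC = 0\<close> and inserting the slopes yields one row of
  the linear system.  The product \<open>q \<eta>\<close>, the only remaining product of two unknowns besides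
  \<open>\<xi> \<eta>\<close>, is affine in \<open>\<xi>\<close> by the first mean equation.\<close>
lemma row_from_exchange:
  fixes n r s c1 c2 v11 v12 v22 W p q w \<xi> \<eta> k GA GC :: "'a::field"
  assumes P1: "(n + r) * (n * c1 * \<xi>) + s * q * (n * c2 * \<eta>) = n * c1"
    and q: "s * c2 * q = c1 * (n + s - mean_det n r s k * \<xi>)"
    and p: "r * c1 * p = c2 * (n + r - mean_det n r s k * \<eta>)"
    and GA: "GA = n\<^sup>2 * (v12 - p * v11)
      + s * k * (n * q * W + n * q * c2 * (n * c2 * \<eta>) + r * k * (n * c1 * \<xi>) * (n * c2 * \<eta>))
      - n * s * k * w"
    and GC: "GC = n\<^sup>2 * (k * v12 - r * s * c1 * c2 * k\<^sup>2 * \<xi> * \<eta> - (2 * v12 - p * v11 - q * v22) - k * w)"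
  shows "r * c1 * c2 * (n * GA - s * GC) = n\<^sup>2 *
    (row_own n r s c1 c2 v22 W k * \<xi> + row_cross n r s c2 v11 k * \<eta>
     + row_prod n r s c1 c2 k * (\<xi> * \<eta>) - row_rhs n r s c1 c2 v11 v12 v22 W k)"
proof -
  have "n * GA - s * GC = n\<^sup>2 * ((n + 2 * s) * v12 - (n + s) * p * v11 + s * q * (k * W - v22)
      - k * s * v12 + r * s * (n + s) * c1 * c2 * k\<^sup>2 * \<xi> * \<eta>
      + k * c2 * (s * q * (n * c2 * \<eta>)))"
    unfolding GA GC by (simp add: algebra_simps power2_eq_square)
  also have "s * q * (n * c2 * \<eta>) = n * c1 - (n + r) * (n * c1 * \<xi>)"
    using P1 by (simp add: algebra_simps)
  finally have E: "n * GA - s * GC = n\<^sup>2 * ((n + 2 * s) * v12 - (n + s) * p * v11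
      + s * q * (k * W - v22) - k * s * v12 + r * s * (n + s) * c1 * c2 * k\<^sup>2 * \<xi> * \<eta>
      + k * c2 * (n * c1 - (n + r) * (n * c1 * \<xi>)))" .
  have "r * c1 * c2 * (n * GA - s * GC) = n\<^sup>2 * (
      r * c1 * c2 * (n + 2 * s) * v12 - (n + s) * c2 * v11 * (r * c1 * p)
      + r * c1 * (k * W - v22) * (s * c2 * q)
      - r * c1 * c2 * k * s * v12 + r * c1 * c2 * (r * s * (n + s) * c1 * c2 * k\<^sup>2 * \<xi> * \<eta>)
      + r * c1 * c2 * (k * c2 * (n * c1 - (n + r) * (n * c1 * \<xi>))))"
    unfolding E by (simp add: algebra_simps)
  also have "\<dots> = n\<^sup>2 *
    (row_own n r s c1 c2 v22 W k * \<xi> + row_cross n r s c2 v11 k * \<eta>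
     + row_prod n r s c1 c2 k * (\<xi> * \<eta>) - row_rhs n r s c1 c2 v11 v12 v22 W k)"
    unfolding p q row_own_def row_cross_def row_prod_def row_rhs_def
    by (intro arg_cong2[where f = "(*)"] refl) (simp add: algebra_simps power2_eq_square)
  finally show ?thesis .
qed

text \<open>The value of \<open>k w\<close> that the score equations force, where \<open>w\<close> is the covariance.\<close>
definition cov_param :: "'a::comm_ring_1 \<Rightarrow> 'a \<Rightarrow> 'a \<Rightarrow> 'a \<Rightarrow> 'a \<Rightarrow> 'a \<Rightarrow> 'a \<Rightarrow> 'a \<Rightarrow> 'a \<Rightarrow> 'a \<Rightarrow> 'a \<Rightarrow> 'a" where
  "cov_param r s c1 c2 v11 v12 v22 p q k \<zeta> =
     k * v12 - r * s * c1 * c2 * k\<^sup>2 * \<zeta> - (2 * v12 - p * v11 - q * v22)"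

text \<open>The heart of the elimination.  With \<open>k\<close> fixed, the score equations determine \<open>q\<close>, \<open>p\<close> and
  \<open>w\<close> from \<open>\<xi>\<close> and \<open>\<eta>\<close> and impose three equations that are linear in \<open>\<xi>\<close>, \<open>\<eta>\<close> and
  \<open>\<xi> \<eta>\<close>.  All three equations for \<open>\<Gamma>\<close> are linear in \<open>w\<close>; they are replaced by the combinations
  \<open>GA\<close>, \<open>GB\<close>, \<open>GC\<close>, each of which expresses a multiple of \<open>k w\<close>.\<close>
lemma reduced_score_iff:
  fixes n r s c1 c2 v11 v12 v22 Z W p q w \<xi> \<eta> k x y g1 g2 g3 :: "'a::field"
  assumes nz: "n \<noteq> 0" "r \<noteq> 0" "s \<noteq> 0" "c1 \<noteq> 0" "c2 \<noteq> 0" "k \<noteq> 0"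
    and x: "x = n * c1 * \<xi>" and y: "y = n * c2 * \<eta>"
    and g1: "g1 = p * (n * (v11 + (x - c1)\<^sup>2) + r * (Z + x\<^sup>2) + s * q\<^sup>2 * (W + y\<^sup>2)) - w * (n + r + s * (p * q))"
    and g2: "g2 = q * (n * (v22 + (y - c2)\<^sup>2) + s * (W + y\<^sup>2) + r * p\<^sup>2 * (Z + x\<^sup>2)) - w * (n + s + r * (q * p))"
    and g3: "g3 = n * (v12 + (x - c1) * (y - c2)) + r * p * (Z + x\<^sup>2) + s * q * (W + y\<^sup>2) - w * (n + r + s)"
  shows "k = 1 - p * q \<and> r * x * k = n * (q * (y - c2) - (x - c1))
      \<and> s * y * k = n * (p * (x - c1) - (y - c2)) \<and> g1 = 0 \<and> g2 = 0 \<and> g3 = 0 \<longleftrightarrow>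
    s * c2 * q = c1 * (n + s - mean_det n r s k * \<xi>)
    \<and> r * c1 * p = c2 * (n + r - mean_det n r s k * \<eta>)
    \<and> k * w = cov_param r s c1 c2 v11 v12 v22 p q k (\<xi> * \<eta>)
    \<and> (n + r) * \<xi> + (n + s) * \<eta> - mean_det n r s k * (\<xi> * \<eta>) = 1
    \<and> row_own n r s c1 c2 v22 W k * \<xi> + row_cross n r s c2 v11 k * \<eta>
       + row_prod n r s c1 c2 k * (\<xi> * \<eta>) = row_rhs n r s c1 c2 v11 v12 v22 W k
    \<and> row_cross n s r c1 v22 k * \<xi> + row_own n s r c2 c1 v11 Z k * \<eta>
       + row_prod n s r c2 c1 k * (\<xi> * \<eta>) = row_rhs n s r c2 c1 v22 v12 v11 Z k"
    (is "?K \<and> ?h2 \<and> ?h1 \<and> _ \<longleftrightarrow> ?q \<and> ?p \<and> ?w \<and> ?H \<and> ?rowI \<and> ?rowII")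
proof -
  define P1 where "P1 = ((n + r) * x + s * q * y = n * c1)"
  define P2 where "P2 = (r * p * x + (n + s) * y = n * c2)"
  have means: "?h2 \<and> ?h1 \<longleftrightarrow> P1 \<and> P2" if k: ?K
  proof
    assume "P1 \<and> P2"
    then have "(n + r) * x + s * q * y - n * c1 = 0" "r * p * x + (n + s) * y - n * c2 = 0"
      by (auto simp: P1_def P2_def)
    moreover have
      "r * x * k - n * (q * (y - c2) - (x - c1)) =
        ((n + r) * x + s * q * y - n * c1) - q * (r * p * x + (n + s) * y - n * c2)"
      "s * y * k - n * (p * (x - c1) - (y - c2)) =
        (r * p * x + (n + s) * y - n * c2) - p * ((n + r) * x + s * q * y - n * c1)"
      unfolding k by (simp_all add: algebra_simps)
    ultimately show "?h2 \<and> ?h1" by simp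
  next
    assume h: "?h2 \<and> ?h1"
    have "k * ((n + r) * x + s * q * y - n * c1) =
       (r * x * k - n * (q * (y - c2) - (x - c1))) + q * (s * y * k - n * (p * (x - c1) - (y - c2)))"
      "k * (r * p * x + (n + s) * y - n * c2) =
       (s * y * k - n * (p * (x - c1) - (y - c2))) + p * (r * x * k - n * (q * (y - c2) - (x - c1)))"
      unfolding k by (simp_all add: algebra_simps)
    then show "P1 \<and> P2" using h nz by (simp add: P1_def P2_def)
  qed
  define form where "form \<longleftrightarrow> ?q \<and> ?p \<and> ?H"
  have forms: "?K \<and> P1 \<and> P2 \<longleftrightarrow> form"
  proof
    assume h: "?K \<and> P1 \<and> P2"
    note fwd = mean_eqs_fwd[OF nz(1,4,5) conjunct1[OF h]
        h[unfolded P1_def P2_def x y, THEN conjunct2, THEN conjunct1]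
        h[unfolded P1_def P2_def x y, THEN conjunct2, THEN conjunct2]]
    show form unfolding form_def using fwd by blast
  next
    assume form
    then have f: ?q ?p ?H unfolding form_def by blast+
    note bwd = mean_eqs_bwd[OF nz(2-5) f]
    have ?K using bwd(1) by (metis diff_diff_eq2 add_diff_cancel_left')
    then show "?K \<and> P1 \<and> P2" unfolding P1_def P2_def x y using bwd(2,3) by blast
  qed
  have rest: "g1 = 0 \<and> g2 = 0 \<and> g3 = 0 \<longleftrightarrow> ?w \<and> ?rowI \<and> ?rowII" if form: form
  proof -
    have k: ?K and P1: P1 and P2: P2 using form forms by auto
    then have h2: ?h2 and h1: ?h1 using means by auto
    have q: ?q and p: ?p using form by (auto simp: form_def)
    define GA where "GA = n\<^sup>2 * (v12 - p * v11)
      + s * k * (n * q * W + n * q * c2 * y + r * k * x * y) - n * s * k * w"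
    define GB where "GB = n\<^sup>2 * (v12 - q * v22)
      + r * k * (n * p * Z + n * p * c1 * x + s * k * y * x) - n * r * k * w"
    define GC where "GC = n\<^sup>2 * (k * v12 - r * s * c1 * c2 * k\<^sup>2 * \<xi> * \<eta>
      - (2 * v12 - p * v11 - q * v22) - k * w)"
    have A: "n * (g3 - g1) = GA" unfolding GA_def
      by (rule diff_exchange[OF k h1 h2 refl refl refl refl g3 g1])
    have k': "k = 1 - q * p" using k by (simp add: mult.commute)
    have g3': "g3 = n * (v12 + (y - c2) * (x - c1)) + s * q * (W + y\<^sup>2) + r * p * (Z + x\<^sup>2)
        - w * (n + s + r)"
      unfolding g3 by (simp add: ac_simps)
    have B: "n * (g3 - g2) = GB" unfolding GB_def
      by (rule diff_exchange[OF k' h2 h1 refl refl refl refl g3' g2])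
    have nf: "n * (y - c2) = - (r * p * x + s * y)"
      using P2 unfolding P2_def by (simp add: algebra_simps)
    have C: "n * g3 = n\<^sup>2 * v12 + r * n * p * (Z + c1 * x) + s * n * q * (W + c2 * y)
        + r * s * k * x * y - n * w * (n + r + s)"
      by (rule cross_moment[OF nf h2 refl refl refl refl refl g3])
    \<comment> \<open>This identity makes the two triples of equations equivalent, as \<open>n\<close> and \<open>k\<close> are invertible.\<close>
    have "k * (n * g3) = GA + GB + GC"
      unfolding C GA_def GB_def GC_def x y by (simp add: algebra_simps power2_eq_square)
    then have "g1 = 0 \<and> g2 = 0 \<and> g3 = 0 \<longleftrightarrow> GA = 0 \<and> GB = 0 \<and> GC = 0"
      unfolding A[symmetric] B[symmetric] using nz by auto
    \<comment> \<open>These two combinations are the ones without \<open>w\<close>.\<close>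
    also have "\<dots> \<longleftrightarrow> GC = 0 \<and> n * GA - s * GC = 0 \<and> n * GB - r * GC = 0"
      using nz by auto
    also have "GC = 0 \<longleftrightarrow> ?w"
    proof -
      have "GC = n\<^sup>2 * (cov_param r s c1 c2 v11 v12 v22 p q k (\<xi> * \<eta>) - k * w)"
        unfolding GC_def cov_param_def by (simp add: mult.assoc)
      then show ?thesis using nz by auto
    qed
    also have "n * GA - s * GC = 0 \<longleftrightarrow> ?rowI"
    proof -
      have "r * c1 * c2 * (n * GA - s * GC) = n\<^sup>2 *
        (row_own n r s c1 c2 v22 W k * \<xi> + row_cross n r s c2 v11 k * \<eta>
         + row_prod n r s c1 c2 k * (\<xi> * \<eta>) - row_rhs n r s c1 c2 v11 v12 v22 W k)"
        by (rule row_from_exchange[OF _ q p GA_def[unfolded x y] GC_def])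
           (use P1 in \<open>simp add: P1_def x y\<close>)
      then show ?thesis using nz by (metis eq_iff_diff_eq_0 mult_eq_0_iff power_eq_0_iff)
    qed
    also have "n * GB - r * GC = 0 \<longleftrightarrow> ?rowII"
    proof -
      have "s * c2 * c1 * (n * GB - r * GC) = n\<^sup>2 *
        (row_own n s r c2 c1 v11 Z k * \<eta> + row_cross n s r c1 v22 k * \<xi>
         + row_prod n s r c2 c1 k * (\<eta> * \<xi>) - row_rhs n s r c2 c1 v22 v12 v11 Z k)"
        by (rule row_from_exchange[OF _ _ _ GB_def[unfolded x y]])
           (use P2 p q in \<open>simp_all add: P2_def x y mean_det_commute[of n s r] GC_def algebra_simps\<close>)
      then have "n * GB - r * GC = 0 \<longleftrightarrow> row_own n s r c2 c1 v11 Z k * \<eta> + row_cross n s r c1 v22 k * \<xi>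
         + row_prod n s r c2 c1 k * (\<eta> * \<xi>) = row_rhs n s r c2 c1 v22 v12 v11 Z k"
        using nz by (metis eq_iff_diff_eq_0 mult_eq_0_iff power_eq_0_iff)
      then show ?thesis by (simp add: ac_simps)
    qed
    finally show ?thesis by blast
  qed
  show ?thesis using means forms rest unfolding form_def by blast
qed

section \<open>Partial derivatives of the log-likelihood\<close>

lemma det_conc_matrix: "Determinants.det (conc_matrix a b c) = a * c - b * b"
  for a b c :: "'a::comm_ring_1"
  by (simp add: conc_matrix_def det_2)

definition gap1 :: "(stat \<Rightarrow> 'a::comm_ring_1) \<Rightarrow> 'a" where "gap1 d = d Mean_Z - d Mean_Y1"
definition gap2 :: "(stat \<Rightarrow> 'a::comm_ring_1) \<Rightarrow> 'a" where "gap2 d = d Mean_W - d Mean_Y2"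
definition cov11 :: "(stat \<Rightarrow> 'a::comm_ring_1) \<Rightarrow> 'a" where "cov11 d = d Mean_Y1Y1 - (d Mean_Y1)\<^sup>2"
definition cov12 :: "(stat \<Rightarrow> 'a::comm_ring_1) \<Rightarrow> 'a" where "cov12 d = d Mean_Y1Y2 - d Mean_Y1 * d Mean_Y2"
definition cov22 :: "(stat \<Rightarrow> 'a::comm_ring_1) \<Rightarrow> 'a" where "cov22 d = d Mean_Y2Y2 - (d Mean_Y2)\<^sup>2"
definition varZ :: "(stat \<Rightarrow> 'a::comm_ring_1) \<Rightarrow> 'a" where "varZ d = d Mean_ZZ - (d Mean_Z)\<^sup>2"
definition varW :: "(stat \<Rightarrow> 'a::comm_ring_1) \<Rightarrow> 'a" where "varW d = d Mean_WW - (d Mean_W)\<^sup>2"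

text \<open>The five partial derivatives of the log-likelihood.  The combinations \<open>cov11 d + (Y - m1)\<^sup>2\<close>
  and so on are the second moments about the current mean.\<close>
definition score_mu1 :: "(stat \<Rightarrow> 'a::field) \<Rightarrow> 'a \<Rightarrow> 'a \<Rightarrow> 'a \<Rightarrow> 'a \<Rightarrow> 'a \<Rightarrow> 'a" where
  "score_mu1 d m1 m2 g11 g12 g22 =
     d Size_n * ((d Mean_Y1 - m1) * g11 + (d Mean_Y2 - m2) * g12)
     + d Size_r * ((g11 * g22 - g12 * g12) / g22) * (d Mean_Z - m1)"

definition score_mu2 :: "(stat \<Rightarrow> 'a::field) \<Rightarrow> 'a \<Rightarrow> 'a \<Rightarrow> 'a \<Rightarrow> 'a \<Rightarrow> 'a \<Rightarrow> 'a" where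
  "score_mu2 d m1 m2 g11 g12 g22 =
     d Size_n * ((d Mean_Y1 - m1) * g12 + (d Mean_Y2 - m2) * g22)
     + d Size_s * ((g11 * g22 - g12 * g12) / g11) * (d Mean_W - m2)"

definition score_g11 :: "(stat \<Rightarrow> 'a::field) \<Rightarrow> 'a \<Rightarrow> 'a \<Rightarrow> 'a \<Rightarrow> 'a \<Rightarrow> 'a \<Rightarrow> 'a" where
  "score_g11 d m1 m2 g11 g12 g22 = 1/2 *
     ((d Size_n + d Size_r + d Size_s) * (g22 / (g11 * g22 - g12 * g12)) - d Size_s * (1 / g11)
      - d Size_n * (cov11 d + (d Mean_Y1 - m1)\<^sup>2) - d Size_r * (varZ d + (d Mean_Z - m1)\<^sup>2)
      - d Size_s * (g12 / g11)\<^sup>2 * (varW d + (d Mean_W - m2)\<^sup>2))"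

definition score_g22 :: "(stat \<Rightarrow> 'a::field) \<Rightarrow> 'a \<Rightarrow> 'a \<Rightarrow> 'a \<Rightarrow> 'a \<Rightarrow> 'a \<Rightarrow> 'a" where
  "score_g22 d m1 m2 g11 g12 g22 = 1/2 *
     ((d Size_n + d Size_r + d Size_s) * (g11 / (g11 * g22 - g12 * g12)) - d Size_r * (1 / g22)
      - d Size_n * (cov22 d + (d Mean_Y2 - m2)\<^sup>2) - d Size_s * (varW d + (d Mean_W - m2)\<^sup>2)
      - d Size_r * (g12 / g22)\<^sup>2 * (varZ d + (d Mean_Z - m1)\<^sup>2))"

definition score_g12 :: "(stat \<Rightarrow> 'a::field) \<Rightarrow> 'a \<Rightarrow> 'a \<Rightarrow> 'a \<Rightarrow> 'a \<Rightarrow> 'a \<Rightarrow> 'a" where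
  "score_g12 d m1 m2 g11 g12 g22 =
     - (d Size_n + d Size_r + d Size_s) * (g12 / (g11 * g22 - g12 * g12))
     - d Size_n * (cov12 d + (d Mean_Y1 - m1) * (d Mean_Y2 - m2))
     + d Size_r * (g12 / g22) * (varZ d + (d Mean_Z - m1)\<^sup>2)
     + d Size_s * (g12 / g11) * (varW d + (d Mean_W - m2)\<^sup>2)"

lemma loglik_centred:
  "loglik lg d (m1, m2, g11, g12, g22) =
     1/2 * (d Size_n + d Size_r + d Size_s) * lg (g11 * g22 - g12 * g12)
     - 1/2 * d Size_r * lg g22 - 1/2 * d Size_s * lg g11
     - d Size_n / 2 * ((cov11 d + (d Mean_Y1 - m1)\<^sup>2) * g11
        + 2 * (cov12 d + (d Mean_Y1 - m1) * (d Mean_Y2 - m2)) * g12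
        + (cov22 d + (d Mean_Y2 - m2)\<^sup>2) * g22)
     - d Size_r / 2 * ((g11 * g22 - g12 * g12) / g22) * (varZ d + (d Mean_Z - m1)\<^sup>2)
     - d Size_s / 2 * ((g11 * g22 - g12 * g12) / g11) * (varW d + (d Mean_W - m2)\<^sup>2)"
proof -
  have "d Mean_Y1Y1 - 2 * m1 * d Mean_Y1 + m1\<^sup>2 = cov11 d + (d Mean_Y1 - m1)\<^sup>2"
    "d Mean_Y2Y2 - 2 * m2 * d Mean_Y2 + m2\<^sup>2 = cov22 d + (d Mean_Y2 - m2)\<^sup>2"
    "d Mean_Y1Y2 - (d Mean_Y1 * m2 + d Mean_Y2 * m1) + m1 * m2
      = cov12 d + (d Mean_Y1 - m1) * (d Mean_Y2 - m2)"
    "d Mean_ZZ - 2 * m1 * d Mean_Z + m1\<^sup>2 = varZ d + (d Mean_Z - m1)\<^sup>2"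
    "d Mean_WW - 2 * m2 * d Mean_W + m2\<^sup>2 = varW d + (d Mean_W - m2)\<^sup>2"
    by (simp_all add: cov11_def cov12_def cov22_def varZ_def varW_def power2_eq_square algebra_simps)
  then show ?thesis by (simp only: loglik.simps Let_def det_conc_matrix)
qed

lemma loglik_partial_derivatives:
  fixes d :: "stat \<Rightarrow> 'a::real_normed_field"
  assumes nz: "g11 \<noteq> 0" "g22 \<noteq> 0" "g11 * g22 - g12 * g12 \<noteq> 0"
    and lg: "\<And>z. z \<in> {g11, g22, g11 * g22 - g12 * g12} \<Longrightarrow> (lg has_field_derivative 1 / z) (at z)"
  shows "((\<lambda>t. loglik lg d (t, m2, g11, g12, g22)) has_field_derivative
            score_mu1 d m1 m2 g11 g12 g22) (at m1)"
    and "((\<lambda>t. loglik lg d (m1, t, g11, g12, g22)) has_field_derivative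
            score_mu2 d m1 m2 g11 g12 g22) (at m2)"
    and "((\<lambda>t. loglik lg d (m1, m2, t, g12, g22)) has_field_derivative
            score_g11 d m1 m2 g11 g12 g22) (at g11)"
    and "((\<lambda>t. loglik lg d (m1, m2, g11, g12, t)) has_field_derivative
            score_g22 d m1 m2 g11 g12 g22) (at g22)"
    and "((\<lambda>t. loglik lg d (m1, m2, g11, t, g22)) has_field_derivative
            score_g12 d m1 m2 g11 g12 g22) (at g12)"
proof -
  have chain: "((\<lambda>t. lg (h t)) has_field_derivative h' / h x) (at x)"
    if "(h has_field_derivative h') (at x)" "h x \<in> {g11, g22, g11 * g22 - g12 * g12}" for h h' x
    using DERIV_chain2[OF lg[OF that(2)] that(1)] by (simp only: times_divide_eq_left mult_1_left)
  define A B where "A = (g11 * g22 - g12 * g12) / g22" and "B = (g11 * g22 - g12 * g12) / g11"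
  show "((\<lambda>t. loglik lg d (t, m2, g11, g12, g22)) has_field_derivative
            score_mu1 d m1 m2 g11 g12 g22) (at m1)"
    unfolding loglik_centred score_mu1_def A_def[symmetric] B_def[symmetric]
    by (rule derivative_eq_intros refl)+ (simp add: algebra_simps)
  show "((\<lambda>t. loglik lg d (m1, t, g11, g12, g22)) has_field_derivative
            score_mu2 d m1 m2 g11 g12 g22) (at m2)"
    unfolding loglik_centred score_mu2_def A_def[symmetric] B_def[symmetric]
    by (rule derivative_eq_intros refl)+ (simp add: algebra_simps)
  \<comment> \<open>With the quotients folded into constants, the final identities become polynomial.\<close>
  define e11 e22 e12 i11 i22 q11 q22 where
    "e11 = g22 / (g11 * g22 - g12 * g12)" and "e22 = g11 / (g11 * g22 - g12 * g12)" and
    "e12 = g12 / (g11 * g22 - g12 * g12)" and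
    "i11 = 1 / g11" and "i22 = 1 / g22" and "q11 = g12 / g11" and "q22 = g12 / g22"
  note quots = this[symmetric]
  have D11: "((\<lambda>t. lg (t * g22 - g12 * g12)) has_field_derivative g22 / (g11 * g22 - g12 * g12)) (at g11)"
    by (rule chain) (rule derivative_eq_intros refl | simp)+
  have D22: "((\<lambda>t. lg (g11 * t - g12 * g12)) has_field_derivative g11 / (g11 * g22 - g12 * g12)) (at g22)"
    by (rule chain) (rule derivative_eq_intros refl | simp)+
  have D12: "((\<lambda>t. lg (g11 * g22 - t * t)) has_field_derivative - 2 * (g12 / (g11 * g22 - g12 * g12))) (at g12)"
    unfolding times_divide_eq_right by (rule chain) (rule derivative_eq_intros refl | simp)+
  have L11: "(lg has_field_derivative 1 / g11) (at g11)" and L22: "(lg has_field_derivative 1 / g22) (at g22)"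
    by (simp_all add: lg)
  have Q11: "((\<lambda>t. (t * g22 - g12 * g12) / g22) has_field_derivative 1) (at g11)"
    "((\<lambda>t. (t * g22 - g12 * g12) / t) has_field_derivative (g12 / g11)\<^sup>2) (at g11)"
    using nz by (auto intro!: derivative_eq_intros simp: field_simps power2_eq_square)
  have Q22: "((\<lambda>t. (g11 * t - g12 * g12) / g11) has_field_derivative 1) (at g22)"
    "((\<lambda>t. (g11 * t - g12 * g12) / t) has_field_derivative (g12 / g22)\<^sup>2) (at g22)"
    using nz by (auto intro!: derivative_eq_intros simp: field_simps power2_eq_square)
  have Q12: "((\<lambda>t. (g11 * g22 - t * t) / g11) has_field_derivative - 2 * (g12 / g11)) (at g12)"
    "((\<lambda>t. (g11 * g22 - t * t) / g22) has_field_derivative - 2 * (g12 / g22)) (at g12)"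
    using nz by (auto intro!: derivative_eq_intros simp: field_simps)
  show "((\<lambda>t. loglik lg d (m1, m2, t, g12, g22)) has_field_derivative
            score_g11 d m1 m2 g11 g12 g22) (at g11)"
    unfolding loglik_centred score_g11_def quots
    by (rule D11[unfolded quots] L11[unfolded quots] Q11[unfolded quots] derivative_eq_intros refl)+ (simp add: algebra_simps add_divide_distrib diff_divide_distrib)
  show "((\<lambda>t. loglik lg d (m1, m2, g11, g12, t)) has_field_derivative
            score_g22 d m1 m2 g11 g12 g22) (at g22)"
    unfolding loglik_centred score_g22_def quots
    by (rule D22[unfolded quots] L22[unfolded quots] Q22[unfolded quots] derivative_eq_intros refl)+ (simp add: algebra_simps add_divide_distrib diff_divide_distrib)
  show "((\<lambda>t. loglik lg d (m1, m2, g11, t, g22)) has_field_derivative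
            score_g12 d m1 m2 g11 g12 g22) (at g12)"
    unfolding loglik_centred score_g12_def quots
    by (rule D12[unfolded quots] Q12[unfolded quots] derivative_eq_intros refl)+ (simp add: algebra_simps add_divide_distrib diff_divide_distrib)
qed

text \<open>Differentiating \<open>exp (L z) = z\<close> determines the derivative of every branch.\<close>
lemma log_branch_derivative:
  assumes "log_branch U L" "z \<in> U"
  shows "(L has_field_derivative 1 / z) (at z)"
proof -
  have U: "open U" "L holomorphic_on U" "\<And>w. w \<in> U \<Longrightarrow> exp (L w) = w"
    using assms(1) by (auto simp: log_branch_def)
  have L: "(L has_field_derivative deriv L z) (at z)"
    using U assms(2) by (intro holomorphic_derivI)
  have "((\<lambda>w. exp (L w)) has_field_derivative exp (L z) * deriv L z) (at z)"
    using L by (auto intro!: derivative_eq_intros)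
  moreover have "((\<lambda>w. exp (L w)) has_field_derivative 1) (at z)"
    by (rule has_field_derivative_transform_within_open[OF DERIV_ident U(1) assms(2)]) (simp add: U)
  ultimately have "z * deriv L z = 1" using U(3)[OF assms(2)] DERIV_unique by metis
  then have "deriv L z = 1 / z"
    by (metis eq_divide_eq mult.commute mult_zero_left zero_neq_one)
  then show ?thesis using L by simp
qed

text \<open>Finitely many nonzero points miss some closed ray from the origin, and the logarithm has a
  branch off that ray.  The ray is taken opposite to \<open>1 + i t\<close>; a given nonzero point lies on
  the real line through the origin and \<open>1 + i t\<close> for at most one \<open>t\<close>.\<close>
lemma log_branch_exists:
  assumes "finite A" "0 \<notin> A"
  obtains U L where "log_branch U L" "A \<subseteq> U"
proof -
  obtain t :: real where t: "t \<notin> (\<lambda>z. Im z / Re z) ` A"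
    using ex_new_if_finite[OF infinite_UNIV_char_0 finite_imageI[OF assms(1)]] by blast
  define c where "c = Complex 1 t"
  have c: "c \<noteq> 0" by (auto simp: c_def complex_eq_iff)
  define U where "U = {z. z / c \<notin> \<real>\<^sub>\<le>\<^sub>0}"
  have "A \<subseteq> U"
  proof
    fix z assume z: "z \<in> A"
    show "z \<in> U"
    proof (rule ccontr)
      assume "z \<notin> U"
      then obtain a :: real where "z / c = of_real a" by (auto simp: U_def elim: nonpos_Reals_cases)
      then have "z = of_real a * c" using c by (simp add: field_simps)
      then have "Re z = a" "Im z = a * t" by (auto simp: c_def)
      moreover have "z \<noteq> 0" using z assms(2) by auto
      ultimately have "t = Im z / Re z" by (auto simp: complex_eq_iff)
      then show False using t z by auto
    qed
  qed
  moreover have "log_branch U (\<lambda>z. Ln (z / c) + Ln c)"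
    unfolding log_branch_def
  proof (intro conjI ballI)
    have "U = (\<lambda>z. z / c) -` (- \<real>\<^sub>\<le>\<^sub>0)" by (auto simp: U_def)
    then show "open U"
      using c by (auto intro!: open_vimage continuous_intros closed_nonpos_Reals_complex simp: open_closed)
    show "(\<lambda>z. Ln (z / c) + Ln c) holomorphic_on U"
      using c by (auto intro!: holomorphic_intros simp: U_def)
    show "exp (Ln (z / c) + Ln c) = z" if "z \<in> U" for z
      using that c by (cases "z = 0") (auto simp: U_def exp_add)
  qed
  ultimately show ?thesis using that by blast
qed

lemma score_solution_iff:
  "score_solution d (m1, m2, g11, g12, g22) \<longleftrightarrow>
     g11 \<noteq> 0 \<and> g22 \<noteq> 0 \<and> g11 * g22 - g12 * g12 \<noteq> 0 \<and>
     score_mu1 d m1 m2 g11 g12 g22 = 0 \<and> score_mu2 d m1 m2 g11 g12 g22 = 0 \<and>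
     score_g11 d m1 m2 g11 g12 g22 = 0 \<and> score_g22 d m1 m2 g11 g12 g22 = 0 \<and>
     score_g12 d m1 m2 g11 g12 g22 = 0" (is "_ \<longleftrightarrow> ?nz1 \<and> ?nz2 \<and> ?nz3 \<and> ?eqs")
proof (cases "?nz1 \<and> ?nz2 \<and> ?nz3")
  case True
  have *: "(((\<lambda>t. loglik L d (t, m2, g11, g12, g22)) has_field_derivative 0) (at m1) \<and>
        ((\<lambda>t. loglik L d (m1, t, g11, g12, g22)) has_field_derivative 0) (at m2) \<and>
        ((\<lambda>t. loglik L d (m1, m2, t, g12, g22)) has_field_derivative 0) (at g11) \<and>
        ((\<lambda>t. loglik L d (m1, m2, g11, g12, t)) has_field_derivative 0) (at g22) \<and>
        ((\<lambda>t. loglik L d (m1, m2, g11, t, g22)) has_field_derivative 0) (at g12)) \<longleftrightarrow> ?eqs"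
    if "log_branch U L" "{g11, g22, g11 * g22 - g12 * g12} \<subseteq> U" for U L
  proof -
    have L: "(L has_field_derivative 1 / z) (at z)" if "z \<in> {g11, g22, g11 * g22 - g12 * g12}" for z
      using log_branch_derivative \<open>log_branch U L\<close> that \<open>_ \<subseteq> U\<close> by blast
    have zero: "(f has_field_derivative 0) (at a) \<longleftrightarrow> e = 0" if "(f has_field_derivative e) (at a)"
      for f :: "complex \<Rightarrow> complex" and e a
      using that DERIV_unique by metis
    show ?thesis
      using True L by (intro arg_cong2[where f = "(\<and>)"] zero loglik_partial_derivatives) auto
  qed
  obtain U L where "log_branch U L" "{g11, g22, g11 * g22 - g12 * g12} \<subseteq> U"
    using log_branch_exists[of "{g11, g22, g11 * g22 - g12 * g12}"] True by auto
  then show ?thesis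
    using True * unfolding score_solution.simps det_conc_matrix by blast
qed (auto simp: det_conc_matrix)

section \<open>The score equations in regression coordinates\<close>

text \<open>The score equations in the coordinates \<open>p = - \<gamma>\<^sub>1\<^sub>2/\<gamma>\<^sub>2\<^sub>2\<close>, \<open>q = - \<gamma>\<^sub>1\<^sub>2/\<gamma>\<^sub>1\<^sub>1\<close> (the two
  regression slopes) and \<open>w = - \<gamma>\<^sub>1\<^sub>2/det \<Gamma>\<close> (the covariance).\<close>
lemma critical_param_iff:
  fixes d :: "stat \<Rightarrow> 'a::field_char_0" and m1 m2 :: 'a
  assumes nz: "p \<noteq> 0" "q \<noteq> 0" "w \<noteq> 0" "k \<noteq> 0" and k: "k = 1 - p * q"
    and g: "g11 = p / (w * k)" "g12 = - (p * q) / (w * k)" "g22 = q / (w * k)"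
  defines "n \<equiv> d Size_n" and "r \<equiv> d Size_r" and "s \<equiv> d Size_s"
    and "x \<equiv> d Mean_Z - m1" and "y \<equiv> d Mean_W - m2"
    and "c1 \<equiv> gap1 d" and "c2 \<equiv> gap2 d"
  shows "score_mu1 d m1 m2 g11 g12 g22 = 0 \<longleftrightarrow> r * x * k = n * (q * (y - c2) - (x - c1))"
    and "score_mu2 d m1 m2 g11 g12 g22 = 0 \<longleftrightarrow> s * y * k = n * (p * (x - c1) - (y - c2))"
    and "score_g11 d m1 m2 g11 g12 g22 = 0 \<longleftrightarrow>
      p * (n * (cov11 d + (x - c1)\<^sup>2) + r * (varZ d + x\<^sup>2) + s * q\<^sup>2 * (varW d + y\<^sup>2))
      - w * (n + r + s * (p * q)) = 0"
    and "score_g22 d m1 m2 g11 g12 g22 = 0 \<longleftrightarrow>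
      q * (n * (cov22 d + (y - c2)\<^sup>2) + s * (varW d + y\<^sup>2) + r * p\<^sup>2 * (varZ d + x\<^sup>2))
      - w * (n + s + r * (q * p)) = 0"
    and "score_g12 d m1 m2 g11 g12 g22 = 0 \<longleftrightarrow>
      n * (cov12 d + (x - c1) * (y - c2)) + r * p * (varZ d + x\<^sup>2) + s * q * (varW d + y\<^sup>2)
      - w * (n + r + s) = 0"
proof -
  have e: "d Mean_Y1 - m1 = x - c1" and f: "d Mean_Y2 - m2 = y - c2"
    by (simp_all add: x_def y_def c1_def c2_def gap1_def gap2_def)
  have gnz: "g11 \<noteq> 0" "g22 \<noteq> 0" using g nz by auto
  have D: "g11 * g22 - g12 * g12 = p * q / (w\<^sup>2 * k)"
  proof -
    have "g11 * g22 - g12 * g12 = (p * q) * (1 - p * q) / (w * k)\<^sup>2"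
      unfolding g by (simp add: divide_simps power2_eq_square nz) (simp add: algebra_simps)
    also have "\<dots> = p * q / (w\<^sup>2 * k)" unfolding k[symmetric] using nz by (simp add: power2_eq_square)
    finally show ?thesis .
  qed
  have quot: "(g11 * g22 - g12 * g12) / g22 = g11 * k" "(g11 * g22 - g12 * g12) / g11 = g22 * k"
    "g12 = - (q * g11)" "g12 = - (p * g22)"
    "g22 / (g11 * g22 - g12 * g12) = w / p" "g11 / (g11 * g22 - g12 * g12) = w / q"
    "g12 / (g11 * g22 - g12 * g12) = - w" "1 / g11 = w * k / p" "1 / g22 = w * k / q"
    "g12 / g11 = - q" "g12 / g22 = - p"
    unfolding D unfolding g using nz by (simp_all add: field_simps power2_eq_square)
  have "score_mu1 d m1 m2 g11 g12 g22 = g11 * (r * x * k - n * (q * (y - c2) - (x - c1)))"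
    unfolding score_mu1_def e f quot(1) n_def[symmetric] r_def[symmetric] x_def[symmetric]
    by (subst quot(3)) (simp add: algebra_simps)
  then show "score_mu1 d m1 m2 g11 g12 g22 = 0 \<longleftrightarrow> r * x * k = n * (q * (y - c2) - (x - c1))"
    using gnz by simp
  have "score_mu2 d m1 m2 g11 g12 g22 = g22 * (s * y * k - n * (p * (x - c1) - (y - c2)))"
    unfolding score_mu2_def e f quot(2) n_def[symmetric] s_def[symmetric] y_def[symmetric]
    by (subst quot(4)) (simp add: algebra_simps)
  then show "score_mu2 d m1 m2 g11 g12 g22 = 0 \<longleftrightarrow> s * y * k = n * (p * (x - c1) - (y - c2))"
    using gnz by simp
  have "2 * p * score_g11 d m1 m2 g11 g12 g22 =
      p * ((n + r + s) * (w / p) - s * (w * k / p) - n * (cov11 d + (x - c1)\<^sup>2)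
        - r * (varZ d + x\<^sup>2) - s * q\<^sup>2 * (varW d + y\<^sup>2))"
    unfolding score_g11_def e f quot(5,10) quot(8)[symmetric] n_def r_def s_def
    by (simp add: x_def y_def)
  also have "\<dots> = - (p * (n * (cov11 d + (x - c1)\<^sup>2) + r * (varZ d + x\<^sup>2) + s * q\<^sup>2 * (varW d + y\<^sup>2))
      - w * (n + r + s * (p * q)))"
  proof -
    have "p * ((n + r + s) * (w / p) - s * (w * k / p)) = w * (n + r + s * (p * q))"
      using nz(1) by (simp add: field_simps k)
    then show ?thesis by (simp add: algebra_simps)
  qed
  finally show "score_g11 d m1 m2 g11 g12 g22 = 0 \<longleftrightarrow>
      p * (n * (cov11 d + (x - c1)\<^sup>2) + r * (varZ d + x\<^sup>2) + s * q\<^sup>2 * (varW d + y\<^sup>2))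
      - w * (n + r + s * (p * q)) = 0"
    using nz by (metis mult_eq_0_iff neg_equal_0_iff_equal zero_neq_numeral)
  have "2 * q * score_g22 d m1 m2 g11 g12 g22 =
      q * ((n + r + s) * (w / q) - r * (w * k / q) - n * (cov22 d + (y - c2)\<^sup>2)
        - s * (varW d + y\<^sup>2) - r * p\<^sup>2 * (varZ d + x\<^sup>2))"
    unfolding score_g22_def e f quot(6,11) quot(9)[symmetric] n_def r_def s_def
    by (simp add: x_def y_def)
  also have "\<dots> = - (q * (n * (cov22 d + (y - c2)\<^sup>2) + s * (varW d + y\<^sup>2) + r * p\<^sup>2 * (varZ d + x\<^sup>2))
      - w * (n + s + r * (q * p)))"
  proof -
    have "q * ((n + r + s) * (w / q) - r * (w * k / q)) = w * (n + s + r * (q * p))"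
      using nz(2) by (simp add: field_simps k)
    then show ?thesis by (simp add: algebra_simps)
  qed
  finally show "score_g22 d m1 m2 g11 g12 g22 = 0 \<longleftrightarrow>
      q * (n * (cov22 d + (y - c2)\<^sup>2) + s * (varW d + y\<^sup>2) + r * p\<^sup>2 * (varZ d + x\<^sup>2))
      - w * (n + s + r * (q * p)) = 0"
    using nz by (metis mult_eq_0_iff neg_equal_0_iff_equal zero_neq_numeral)
  have "score_g12 d m1 m2 g11 g12 g22 =
     - (n * (cov12 d + (x - c1) * (y - c2)) + r * p * (varZ d + x\<^sup>2) + s * q * (varW d + y\<^sup>2)
      - w * (n + r + s))"
    unfolding score_g12_def e f quot(7,10,11) n_def r_def s_def
    by (simp add: x_def y_def algebra_simps)
  then show "score_g12 d m1 m2 g11 g12 g22 = 0 \<longleftrightarrow>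
      n * (cov12 d + (x - c1) * (y - c2)) + r * p * (varZ d + x\<^sup>2) + s * q * (varW d + y\<^sup>2)
      - w * (n + r + s) = 0"
    by (simp only: neg_equal_0_iff_equal)
qed

text \<open>The coordinates above need \<open>\<gamma>\<^sub>1\<^sub>2 \<noteq> 0\<close>.  If \<open>\<gamma>\<^sub>1\<^sub>2 = 0\<close>, then the means are weighted
  averages of the sample means of the two variables separately, and the equation for \<open>\<gamma>\<^sub>1\<^sub>2\<close>
  becomes the following condition on the data alone.\<close>
lemma critical_g12_nonzero:
  fixes d :: "stat \<Rightarrow> 'a::field"
  assumes "score_mu1 d m1 m2 g11 0 g22 = 0" "score_mu2 d m1 m2 g11 0 g22 = 0"
    "score_g12 d m1 m2 g11 0 g22 = 0" and nz: "g11 \<noteq> 0" "g22 \<noteq> 0" "d Size_n \<noteq> 0"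
  shows "(d Size_n + d Size_r) * (d Size_n + d Size_s) * cov12 d
      + d Size_r * d Size_s * gap1 d * gap2 d = 0"
proof -
  define e f where "e = d Mean_Y1 - m1" and "f = d Mean_Y2 - m2"
  have "score_mu1 d m1 m2 g11 0 g22 = g11 * ((d Size_n + d Size_r) * e + d Size_r * gap1 d)"
    "score_mu2 d m1 m2 g11 0 g22 = g22 * ((d Size_n + d Size_s) * f + d Size_s * gap2 d)"
    using nz by (simp_all add: score_mu1_def score_mu2_def e_def f_def gap1_def gap2_def algebra_simps)
  then have ef: "(d Size_n + d Size_r) * e = - (d Size_r * gap1 d)"
     "(d Size_n + d Size_s) * f = - (d Size_s * gap2 d)"
    using assms by (simp_all add: eq_neg_iff_add_eq_0)
  have "cov12 d = - (e * f)"
    using assms by (simp add: score_g12_def e_def f_def eq_neg_iff_add_eq_0)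
  then have "(d Size_n + d Size_r) * (d Size_n + d Size_s) * cov12 d =
      - (((d Size_n + d Size_r) * e) * ((d Size_n + d Size_s) * f))" by simp
  then show ?thesis unfolding ef by simp
qed

section \<open>The eliminant and its roots\<close>

definition det3 ::
  "'a::comm_ring_1 \<Rightarrow> 'a \<Rightarrow> 'a \<Rightarrow> 'a \<Rightarrow> 'a \<Rightarrow> 'a \<Rightarrow> 'a \<Rightarrow> 'a \<Rightarrow> 'a \<Rightarrow> 'a" where
  "det3 a1 a2 a3 b1 b2 b3 e1 e2 e3 =
     a1 * (b2 * e3 - b3 * e2) - a2 * (b1 * e3 - b3 * e1) + a3 * (b1 * e2 - b2 * e1)"

lemma cramer3:
  fixes a1 :: "'a::field"
  assumes "a1 * x + a2 * y + a3 * z = u" "b1 * x + b2 * y + b3 * z = v" "e1 * x + e2 * y + e3 * z = w"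
  shows "det3 a1 a2 a3 b1 b2 b3 e1 e2 e3 * x = det3 u a2 a3 v b2 b3 w e2 e3"
    and "det3 a1 a2 a3 b1 b2 b3 e1 e2 e3 * y = det3 a1 u a3 b1 v b3 e1 w e3"
    and "det3 a1 a2 a3 b1 b2 b3 e1 e2 e3 * z = det3 a1 a2 u b1 b2 v e1 e2 w"
  unfolding assms[symmetric] det3_def by (simp_all add: algebra_simps)

lemma cramer3_solves:
  fixes a1 :: "'a::field"
  assumes "det3 a1 a2 a3 b1 b2 b3 e1 e2 e3 \<noteq> 0"
    and "det3 a1 a2 a3 b1 b2 b3 e1 e2 e3 * x = det3 u a2 a3 v b2 b3 w e2 e3"
    and "det3 a1 a2 a3 b1 b2 b3 e1 e2 e3 * y = det3 a1 u a3 b1 v b3 e1 w e3"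
    and "det3 a1 a2 a3 b1 b2 b3 e1 e2 e3 * z = det3 a1 a2 u b1 b2 v e1 e2 w"
  shows "a1 * x + a2 * y + a3 * z = u" "b1 * x + b2 * y + b3 * z = v" "e1 * x + e2 * y + e3 * z = w"
proof -
  let ?D = "det3 a1 a2 a3 b1 b2 b3 e1 e2 e3"
  have *: "l * x + m * y + o' * z = t"
    if "l * det3 u a2 a3 v b2 b3 w e2 e3 + m * det3 a1 u a3 b1 v b3 e1 w e3
      + o' * det3 a1 a2 u b1 b2 v e1 e2 w = ?D * t" for l m o' t
  proof -
    have "?D * (l * x + m * y + o' * z) = l * (?D * x) + m * (?D * y) + o' * (?D * z)"
      by (simp add: algebra_simps)
    also have "\<dots> = ?D * t" unfolding assms(2-4) by (rule that)
    finally show ?thesis using assms(1) by simp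
  qed
  show "a1 * x + a2 * y + a3 * z = u" "b1 * x + b2 * y + b3 * z = v" "e1 * x + e2 * y + e3 * z = w"
    by (rule *; simp add: det3_def algebra_simps)+
qed

definition score_rows :: "(stat \<Rightarrow> 'a::comm_ring_1) \<Rightarrow> 'a \<Rightarrow> 'a \<Rightarrow> 'a \<Rightarrow> 'a \<Rightarrow> bool" where
  "score_rows d k \<xi> \<eta> \<zeta> \<longleftrightarrow>
    (d Size_n + d Size_r) * \<xi> + (d Size_n + d Size_s) * \<eta>
      + (- mean_det (d Size_n) (d Size_r) (d Size_s) k) * \<zeta> = 1 \<and>
    row_own (d Size_n) (d Size_r) (d Size_s) (gap1 d) (gap2 d) (cov22 d) (varW d) k * \<xi>
      + row_cross (d Size_n) (d Size_r) (d Size_s) (gap2 d) (cov11 d) k * \<eta>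
      + row_prod (d Size_n) (d Size_r) (d Size_s) (gap1 d) (gap2 d) k * \<zeta>
      = row_rhs (d Size_n) (d Size_r) (d Size_s) (gap1 d) (gap2 d) (cov11 d) (cov12 d) (cov22 d) (varW d) k \<and>
    row_cross (d Size_n) (d Size_s) (d Size_r) (gap1 d) (cov22 d) k * \<xi>
      + row_own (d Size_n) (d Size_s) (d Size_r) (gap2 d) (gap1 d) (cov11 d) (varZ d) k * \<eta>
      + row_prod (d Size_n) (d Size_s) (d Size_r) (gap2 d) (gap1 d) k * \<zeta>
      = row_rhs (d Size_n) (d Size_s) (d Size_r) (gap2 d) (gap1 d) (cov22 d) (cov12 d) (cov11 d) (varZ d) k"

definition cramer_den :: "(stat \<Rightarrow> 'a::comm_ring_1) \<Rightarrow> 'a \<Rightarrow> 'a" where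
  "cramer_den d k = det3
     (d Size_n + d Size_r) (d Size_n + d Size_s) (- mean_det (d Size_n) (d Size_r) (d Size_s) k)
     (row_own (d Size_n) (d Size_r) (d Size_s) (gap1 d) (gap2 d) (cov22 d) (varW d) k)
     (row_cross (d Size_n) (d Size_r) (d Size_s) (gap2 d) (cov11 d) k)
     (row_prod (d Size_n) (d Size_r) (d Size_s) (gap1 d) (gap2 d) k)
     (row_cross (d Size_n) (d Size_s) (d Size_r) (gap1 d) (cov22 d) k)
     (row_own (d Size_n) (d Size_s) (d Size_r) (gap2 d) (gap1 d) (cov11 d) (varZ d) k)
     (row_prod (d Size_n) (d Size_s) (d Size_r) (gap2 d) (gap1 d) k)"

definition cramer_xi :: "(stat \<Rightarrow> 'a::comm_ring_1) \<Rightarrow> 'a \<Rightarrow> 'a" where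
  "cramer_xi d k = det3
     1 (d Size_n + d Size_s) (- mean_det (d Size_n) (d Size_r) (d Size_s) k)
     (row_rhs (d Size_n) (d Size_r) (d Size_s) (gap1 d) (gap2 d) (cov11 d) (cov12 d) (cov22 d) (varW d) k)
     (row_cross (d Size_n) (d Size_r) (d Size_s) (gap2 d) (cov11 d) k)
     (row_prod (d Size_n) (d Size_r) (d Size_s) (gap1 d) (gap2 d) k)
     (row_rhs (d Size_n) (d Size_s) (d Size_r) (gap2 d) (gap1 d) (cov22 d) (cov12 d) (cov11 d) (varZ d) k)
     (row_own (d Size_n) (d Size_s) (d Size_r) (gap2 d) (gap1 d) (cov11 d) (varZ d) k)
     (row_prod (d Size_n) (d Size_s) (d Size_r) (gap2 d) (gap1 d) k)"

definition cramer_eta :: "(stat \<Rightarrow> 'a::comm_ring_1) \<Rightarrow> 'a \<Rightarrow> 'a" where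
  "cramer_eta d k = det3
     (d Size_n + d Size_r) 1 (- mean_det (d Size_n) (d Size_r) (d Size_s) k)
     (row_own (d Size_n) (d Size_r) (d Size_s) (gap1 d) (gap2 d) (cov22 d) (varW d) k)
     (row_rhs (d Size_n) (d Size_r) (d Size_s) (gap1 d) (gap2 d) (cov11 d) (cov12 d) (cov22 d) (varW d) k)
     (row_prod (d Size_n) (d Size_r) (d Size_s) (gap1 d) (gap2 d) k)
     (row_cross (d Size_n) (d Size_s) (d Size_r) (gap1 d) (cov22 d) k)
     (row_rhs (d Size_n) (d Size_s) (d Size_r) (gap2 d) (gap1 d) (cov22 d) (cov12 d) (cov11 d) (varZ d) k)
     (row_prod (d Size_n) (d Size_s) (d Size_r) (gap2 d) (gap1 d) k)"

definition cramer_zeta :: "(stat \<Rightarrow> 'a::comm_ring_1) \<Rightarrow> 'a \<Rightarrow> 'a" where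
  "cramer_zeta d k = det3
     (d Size_n + d Size_r) (d Size_n + d Size_s) 1
     (row_own (d Size_n) (d Size_r) (d Size_s) (gap1 d) (gap2 d) (cov22 d) (varW d) k)
     (row_cross (d Size_n) (d Size_r) (d Size_s) (gap2 d) (cov11 d) k)
     (row_rhs (d Size_n) (d Size_r) (d Size_s) (gap1 d) (gap2 d) (cov11 d) (cov12 d) (cov22 d) (varW d) k)
     (row_cross (d Size_n) (d Size_s) (d Size_r) (gap1 d) (cov22 d) k)
     (row_own (d Size_n) (d Size_s) (d Size_r) (gap2 d) (gap1 d) (cov11 d) (varZ d) k)
     (row_rhs (d Size_n) (d Size_s) (d Size_r) (gap2 d) (gap1 d) (cov22 d) (cov12 d) (cov11 d) (varZ d) k)"

text \<open>The univariate equation for \<open>k\<close>: Cramer's rule applied to the linear system, followed by the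
  requirement \<open>\<zeta> = \<xi> \<eta>\<close> with denominators cleared.\<close>
definition eliminant :: "(stat \<Rightarrow> 'a::comm_ring_1) \<Rightarrow> 'a \<Rightarrow> 'a" where
  "eliminant d k = cramer_xi d k * cramer_eta d k - cramer_zeta d k * cramer_den d k"

text \<open>The numerator of the covariance \<open>w\<close> as a function of \<open>k\<close>.  Its roots have to be avoided,
  because the variances \<open>w/p\<close> and \<open>w/q\<close> must not vanish.\<close>
definition cov_num :: "(stat \<Rightarrow> 'a::comm_ring_1) \<Rightarrow> 'a \<Rightarrow> 'a" where
  "cov_num d k =
     d Size_r * d Size_s * gap1 d * gap2 d *
       ((k - 2) * cov12 d * cramer_den d k
        - d Size_r * d Size_s * gap1 d * gap2 d * k\<^sup>2 * cramer_zeta d k)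
     + d Size_s * (gap2 d)\<^sup>2 * cov11 d *
       ((d Size_n + d Size_r) * cramer_den d k - mean_det (d Size_n) (d Size_r) (d Size_s) k * cramer_eta d k)
     + d Size_r * (gap1 d)\<^sup>2 * cov22 d *
       ((d Size_n + d Size_s) * cramer_den d k - mean_det (d Size_n) (d Size_r) (d Size_s) k * cramer_xi d k)"

lemma score_rows_cramer:
  fixes d :: "stat \<Rightarrow> 'a::field"
  assumes "score_rows d k \<xi> \<eta> \<zeta>"
  shows "cramer_den d k * \<xi> = cramer_xi d k" "cramer_den d k * \<eta> = cramer_eta d k"
    "cramer_den d k * \<zeta> = cramer_zeta d k"
  using assms unfolding score_rows_def cramer_den_def cramer_xi_def cramer_eta_def cramer_zeta_def
  by (blast intro: cramer3)+

lemma score_rows_of_cramer: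
  fixes d :: "stat \<Rightarrow> 'a::field"
  assumes "cramer_den d k \<noteq> 0"
    "cramer_den d k * \<xi> = cramer_xi d k" "cramer_den d k * \<eta> = cramer_eta d k"
    "cramer_den d k * \<zeta> = cramer_zeta d k"
  shows "score_rows d k \<xi> \<eta> \<zeta>"
  unfolding score_rows_def
  using cramer3_solves[OF assms[unfolded cramer_den_def cramer_xi_def cramer_eta_def cramer_zeta_def]]
  by blast

definition cov_solution :: "(stat \<Rightarrow> 'a::field) \<Rightarrow> 'a \<Rightarrow> 'a \<Rightarrow> 'a \<Rightarrow> 'a \<Rightarrow> 'a \<Rightarrow> 'a \<Rightarrow> bool" where
  "cov_solution d k \<xi> \<eta> p q w \<longleftrightarrow>
     d Size_s * gap2 d * q = gap1 d * (d Size_n + d Size_s - mean_det (d Size_n) (d Size_r) (d Size_s) k * \<xi>)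
   \<and> d Size_r * gap1 d * p = gap2 d * (d Size_n + d Size_r - mean_det (d Size_n) (d Size_r) (d Size_s) k * \<eta>)
   \<and> k * w = cov_param (d Size_r) (d Size_s) (gap1 d) (gap2 d) (cov11 d) (cov12 d) (cov22 d) p q k (\<xi> * \<eta>)"

lemma score_solution_param_iff:
  fixes d :: "stat \<Rightarrow> complex"
  assumes nz: "d Size_n \<noteq> 0" "d Size_r \<noteq> 0" "d Size_s \<noteq> 0" "gap1 d \<noteq> 0" "gap2 d \<noteq> 0"
    and pq: "p \<noteq> 0" "q \<noteq> 0" "w \<noteq> 0" "k \<noteq> 0"
  shows "k = 1 - p * q \<and> score_solution d
       (d Mean_Z - d Size_n * gap1 d * \<xi>, d Mean_W - d Size_n * gap2 d * \<eta>,
        p / (w * k), - (p * q) / (w * k), q / (w * k))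
    \<longleftrightarrow> cov_solution d k \<xi> \<eta> p q w \<and> score_rows d k \<xi> \<eta> (\<xi> * \<eta>)"
proof -
  have red: "k = 1 - p * q \<and> score_solution d
       (d Mean_Z - d Size_n * gap1 d * \<xi>, d Mean_W - d Size_n * gap2 d * \<eta>,
        p / (w * k), - (p * q) / (w * k), q / (w * k)) \<longleftrightarrow> k = 1 - p * q \<and>
    d Size_r * (d Size_n * gap1 d * \<xi>) * k =
      d Size_n * (q * (d Size_n * gap2 d * \<eta> - gap2 d) - (d Size_n * gap1 d * \<xi> - gap1 d)) \<and>
    d Size_s * (d Size_n * gap2 d * \<eta>) * k =
      d Size_n * (p * (d Size_n * gap1 d * \<xi> - gap1 d) - (d Size_n * gap2 d * \<eta> - gap2 d)) \<and>
    p * (d Size_n * (cov11 d + (d Size_n * gap1 d * \<xi> - gap1 d)\<^sup>2)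
        + d Size_r * (varZ d + (d Size_n * gap1 d * \<xi>)\<^sup>2)
        + d Size_s * q\<^sup>2 * (varW d + (d Size_n * gap2 d * \<eta>)\<^sup>2))
      - w * (d Size_n + d Size_r + d Size_s * (p * q)) = 0 \<and>
    q * (d Size_n * (cov22 d + (d Size_n * gap2 d * \<eta> - gap2 d)\<^sup>2)
        + d Size_s * (varW d + (d Size_n * gap2 d * \<eta>)\<^sup>2)
        + d Size_r * p\<^sup>2 * (varZ d + (d Size_n * gap1 d * \<xi>)\<^sup>2))
      - w * (d Size_n + d Size_s + d Size_r * (q * p)) = 0 \<and>
    d Size_n * (cov12 d + (d Size_n * gap1 d * \<xi> - gap1 d) * (d Size_n * gap2 d * \<eta> - gap2 d))
      + d Size_r * p * (varZ d + (d Size_n * gap1 d * \<xi>)\<^sup>2)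
      + d Size_s * q * (varW d + (d Size_n * gap2 d * \<eta>)\<^sup>2)
      - w * (d Size_n + d Size_r + d Size_s) = 0"
    (is "?K \<and> ?sol \<longleftrightarrow> ?K \<and> ?eqs")
  proof (rule conj_cong[OF refl])
    assume K: ?K
    have "p / (w * k) * (q / (w * k)) - - (p * q) / (w * k) * (- (p * q) / (w * k))
        = (p * q) * (1 - p * q) / (w * k)\<^sup>2"
      using pq by (simp add: divide_simps power2_eq_square) (simp add: algebra_simps)
    then have "p / (w * k) * (q / (w * k)) - - (p * q) / (w * k) * (- (p * q) / (w * k)) \<noteq> 0"
      using pq K by simp
    then show "?sol \<longleftrightarrow> ?eqs"
      unfolding score_solution_iff critical_param_iff[OF pq K refl refl refl]
      using pq by simp
  qed
  show ?thesis
    unfolding red cov_solution_def score_rows_def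
    unfolding reduced_score_iff[OF nz pq(4) refl refl refl refl refl]
    by (simp add: conj_assoc)
qed

lemma cov_num_eq:
  fixes d :: "stat \<Rightarrow> 'a::field"
  assumes rows: "score_rows d k \<xi> \<eta> (\<xi> * \<eta>)" and sol: "cov_solution d k \<xi> \<eta> p q w"
  shows "cov_num d k = d Size_r * d Size_s * gap1 d * gap2 d * cramer_den d k * (k * w)"
proof -
  note cr = score_rows_cramer[OF rows, symmetric]
  define S where "S = mean_det (d Size_n) (d Size_r) (d Size_s) k"
  have q: "d Size_s * gap2 d * q = gap1 d * (d Size_n + d Size_s - S * \<xi>)"
    and p: "d Size_r * gap1 d * p = gap2 d * (d Size_n + d Size_r - S * \<eta>)"
    and w: "k * w = cov_param (d Size_r) (d Size_s) (gap1 d) (gap2 d) (cov11 d) (cov12 d) (cov22 d) p q k (\<xi> * \<eta>)"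
    using sol unfolding cov_solution_def S_def by blast+
  have "cov_num d k = cramer_den d k * (d Size_r * d Size_s * gap1 d * gap2 d *
       ((k - 2) * cov12 d - d Size_r * d Size_s * gap1 d * gap2 d * k\<^sup>2 * (\<xi> * \<eta>))
     + d Size_s * gap2 d * cov11 d * (gap2 d * (d Size_n + d Size_r - S * \<eta>))
     + d Size_r * gap1 d * cov22 d * (gap1 d * (d Size_n + d Size_s - S * \<xi>)))"
    unfolding cov_num_def cr S_def by (simp add: algebra_simps power2_eq_square)
  also have "\<dots> = d Size_r * d Size_s * gap1 d * gap2 d * cramer_den d k * (k * w)"
    unfolding w p[symmetric] q[symmetric] cov_param_def by (simp add: algebra_simps)
  finally show ?thesis .
qed

text \<open>Everything that the correspondence between critical points and roots of the eliminant needs.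
  A root \<open>k = 0\<close> would give a singular \<open>\<Gamma>\<close>, a root \<open>k = 1\<close> would give \<open>p q = 0\<close>.\<close>
definition generic_data :: "(stat \<Rightarrow> complex) \<Rightarrow> bool" where
  "generic_data d \<longleftrightarrow>
     d Size_n \<noteq> 0 \<and> d Size_r \<noteq> 0 \<and> d Size_s \<noteq> 0 \<and> gap1 d \<noteq> 0 \<and> gap2 d \<noteq> 0
   \<and> (d Size_n + d Size_r) * (d Size_n + d Size_s) * cov12 d
       + d Size_r * d Size_s * gap1 d * gap2 d \<noteq> 0
   \<and> eliminant d 0 \<noteq> 0 \<and> eliminant d 1 \<noteq> 0
   \<and> (\<forall>k. eliminant d k = 0 \<longrightarrow> cramer_den d k \<noteq> 0 \<and> cov_num d k \<noteq> 0)"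

text \<open>The coordinate \<open>k = 1 - p q\<close>, which is one minus the squared correlation.\<close>
fun one_minus_sq_corr :: "complex param \<Rightarrow> complex" where
  "one_minus_sq_corr (m1, m2, g11, g12, g22) = 1 - g12 * g12 / (g11 * g22)"

text \<open>Since \<open>\<gamma>\<^sub>1\<^sub>2\<close> cannot vanish, every critical point has regression coordinates.\<close>
lemma score_solution_coordinates:
  assumes gen: "generic_data d" and sol: "score_solution d \<theta>"
  obtains \<xi> \<eta> p q w k where "p \<noteq> 0" "q \<noteq> 0" "w \<noteq> 0" "k \<noteq> 0" "k = one_minus_sq_corr \<theta>"
    "cov_solution d k \<xi> \<eta> p q w" "score_rows d k \<xi> \<eta> (\<xi> * \<eta>)"
    "\<theta> = (d Mean_Z - d Size_n * gap1 d * \<xi>, d Mean_W - d Size_n * gap2 d * \<eta>,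
        p / (w * k), - (p * q) / (w * k), q / (w * k))"
proof -
  obtain m1 m2 g11 g12 g22 where \<theta>: "\<theta> = (m1, m2, g11, g12, g22)" by (cases \<theta>) auto
  define D where "D = g11 * g22 - g12 * g12"
  have nz: "d Size_n \<noteq> 0" "d Size_r \<noteq> 0" "d Size_s \<noteq> 0" "gap1 d \<noteq> 0" "gap2 d \<noteq> 0"
    using gen by (auto simp: generic_data_def)
  have g: "g11 \<noteq> 0" "g22 \<noteq> 0" "D \<noteq> 0" and "score_mu1 d m1 m2 g11 g12 g22 = 0"
    "score_mu2 d m1 m2 g11 g12 g22 = 0" "score_g12 d m1 m2 g11 g12 g22 = 0"
    using sol unfolding \<theta> score_solution_iff D_def by blast+
  then have g12: "g12 \<noteq> 0"
    using critical_g12_nonzero[of d m1 m2 g11 g22] gen nz by (auto simp: generic_data_def)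
  define p q w k where "p = - g12 / g22" and "q = - g12 / g11" and "w = - g12 / D"
    and "k = D / (g11 * g22)"
  have pqwk: "p \<noteq> 0" "q \<noteq> 0" "w \<noteq> 0" "k \<noteq> 0"
    using g g12 by (auto simp: p_def q_def w_def k_def)
  have unc: "k = 1 - g12 * g12 / (g11 * g22)"
    using g by (simp add: k_def D_def diff_divide_distrib)
  have k: "k = 1 - p * q" unfolding unc by (simp add: p_def q_def)
  define \<xi> \<eta> where "\<xi> = (d Mean_Z - m1) / (d Size_n * gap1 d)"
    and "\<eta> = (d Mean_W - m2) / (d Size_n * gap2 d)"
  have \<theta>': "\<theta> = (d Mean_Z - d Size_n * gap1 d * \<xi>, d Mean_W - d Size_n * gap2 d * \<eta>,
        p / (w * k), - (p * q) / (w * k), q / (w * k))"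
    using g g12 nz by (simp add: \<theta> \<xi>_def \<eta>_def p_def q_def w_def k_def)
  show ?thesis
  proof (rule that[OF pqwk _ _ _ \<theta>'])
    show "k = one_minus_sq_corr \<theta>" using unc by (simp add: \<theta>)
    have "cov_solution d k \<xi> \<eta> p q w \<and> score_rows d k \<xi> \<eta> (\<xi> * \<eta>)"
      using score_solution_param_iff[OF nz pqwk] k sol \<theta>' by blast
    then show "cov_solution d k \<xi> \<eta> p q w" "score_rows d k \<xi> \<eta> (\<xi> * \<eta>)" by blast+
  qed
qed

text \<open>Injectivity: \<open>k\<close> determines \<open>\<xi>\<close>, \<open>\<eta>\<close> by Cramer's rule, then the slopes, the covariance and
  thus the parameter.  Surjectivity: at a root of the eliminant the Cramer solution satisfies
  \<open>\<zeta> = \<xi> \<eta>\<close>, and genericity makes the resulting \<open>p\<close>, \<open>q\<close>, \<open>w\<close> nonzero.\<close>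
lemma score_solutions_bij_roots:
  assumes gen: "generic_data d"
  shows "bij_betw one_minus_sq_corr {\<theta>. score_solution d \<theta>} {k. eliminant d k = 0}"
  unfolding bij_betw_def
proof
  have nz: "d Size_n \<noteq> 0" "d Size_r \<noteq> 0" "d Size_s \<noteq> 0" "gap1 d \<noteq> 0" "gap2 d \<noteq> 0"
    using gen by (auto simp: generic_data_def)
  have elim0: "eliminant d k = 0" if "score_rows d k \<xi> \<eta> (\<xi> * \<eta>)" for k \<xi> \<eta>
    using score_rows_cramer[OF that, symmetric] by (simp add: eliminant_def)
  show "inj_on one_minus_sq_corr {\<theta>. score_solution d \<theta>}"
  proof (rule inj_onI)
    fix \<theta> \<theta>' assume "\<theta> \<in> {\<theta>. score_solution d \<theta>}" "\<theta>' \<in> {\<theta>. score_solution d \<theta>}"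
      and eq: "one_minus_sq_corr \<theta> = one_minus_sq_corr \<theta>'"
    then have "score_solution d \<theta>" "score_solution d \<theta>'" by simp_all
    obtain \<xi> \<eta> p q w k where k: "k = one_minus_sq_corr \<theta>" "k \<noteq> 0"
      and sol: "cov_solution d k \<xi> \<eta> p q w" and rows: "score_rows d k \<xi> \<eta> (\<xi> * \<eta>)"
      and \<theta>: "\<theta> = (d Mean_Z - d Size_n * gap1 d * \<xi>, d Mean_W - d Size_n * gap2 d * \<eta>,
        p / (w * k), - (p * q) / (w * k), q / (w * k))"
      using score_solution_coordinates[OF gen \<open>score_solution d \<theta>\<close>] by metis
    obtain \<xi>' \<eta>' p' q' w' where sol': "cov_solution d k \<xi>' \<eta>' p' q' w'"
      and rows': "score_rows d k \<xi>' \<eta>' (\<xi>' * \<eta>')"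
      and \<theta>': "\<theta>' = (d Mean_Z - d Size_n * gap1 d * \<xi>', d Mean_W - d Size_n * gap2 d * \<eta>',
        p' / (w' * k), - (p' * q') / (w' * k), q' / (w' * k))"
      using score_solution_coordinates[OF gen \<open>score_solution d \<theta>'\<close>] k eq by metis
    have "cramer_den d k \<noteq> 0" using gen elim0[OF rows] by (auto simp: generic_data_def)
    then have xy: "\<xi>' = \<xi>" "\<eta>' = \<eta>"
      using score_rows_cramer[OF rows] score_rows_cramer[OF rows'] by (metis mult_left_cancel)+
    have "d Size_s * gap2 d * q' = d Size_s * gap2 d * q" "d Size_r * gap1 d * p' = d Size_r * gap1 d * p"
      using sol sol' unfolding cov_solution_def xy by simp_all
    then have pq: "p' = p" "q' = q" using nz by auto
    have "k * w' = k * w" using sol sol' unfolding cov_solution_def xy pq by simp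
    then have "w' = w" using k by simp
    then show "\<theta> = \<theta>'" unfolding \<theta> \<theta>' xy pq by simp
  qed
  show "one_minus_sq_corr ` {\<theta>. score_solution d \<theta>} = {k. eliminant d k = 0}"
  proof (intro subset_antisym subsetI)
    fix k assume "k \<in> one_minus_sq_corr ` {\<theta>. score_solution d \<theta>}"
    then obtain \<theta> where "score_solution d \<theta>" "k = one_minus_sq_corr \<theta>" by auto
    then obtain \<xi> \<eta> where "score_rows d k \<xi> \<eta> (\<xi> * \<eta>)"
      using score_solution_coordinates[OF gen] by metis
    then show "k \<in> {k. eliminant d k = 0}" using elim0 by simp
  next
    fix k assume "k \<in> {k. eliminant d k = 0}"
    then have root: "eliminant d k = 0" by simp
    then have den: "cramer_den d k \<noteq> 0" and num: "cov_num d k \<noteq> 0" and k0: "k \<noteq> 0" and k1: "k \<noteq> 1"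
      using gen by (auto simp: generic_data_def)
    define \<xi> \<eta> where "\<xi> = cramer_xi d k / cramer_den d k" and "\<eta> = cramer_eta d k / cramer_den d k"
    have rows: "score_rows d k \<xi> \<eta> (\<xi> * \<eta>)"
      by (rule score_rows_of_cramer[OF den])
         (use den root in \<open>simp_all add: \<xi>_def \<eta>_def eliminant_def divide_simps\<close>)
    define q where "q = gap1 d * (d Size_n + d Size_s - mean_det (d Size_n) (d Size_r) (d Size_s) k * \<xi>)
        / (d Size_s * gap2 d)"
    define p where "p = gap2 d * (d Size_n + d Size_r - mean_det (d Size_n) (d Size_r) (d Size_s) k * \<eta>)
        / (d Size_r * gap1 d)"
    define w where "w = cov_param (d Size_r) (d Size_s) (gap1 d) (gap2 d) (cov11 d) (cov12 d) (cov22 d)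
        p q k (\<xi> * \<eta>) / k"
    have sol: "cov_solution d k \<xi> \<eta> p q w"
      using nz k0 by (simp add: cov_solution_def p_def q_def w_def)
    have w0: "w \<noteq> 0" using cov_num_eq[OF rows sol] num by auto
    have "p * q = 1 - k"
      using mean_eqs_bwd(1)[OF nz(2-5), of q "d Size_n" k \<xi> p \<eta>] sol rows
      unfolding cov_solution_def score_rows_def by simp
    then have pq: "p \<noteq> 0" "q \<noteq> 0" using k1 by auto
    note iff = score_solution_param_iff[OF nz pq w0 k0, of \<xi> \<eta>]
    let ?\<theta> = "(d Mean_Z - d Size_n * gap1 d * \<xi>, d Mean_W - d Size_n * gap2 d * \<eta>,
        p / (w * k), - (p * q) / (w * k), q / (w * k))"
    have "score_solution d ?\<theta>" and k: "k = 1 - p * q" using iff sol rows by blast+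
    moreover have "one_minus_sq_corr ?\<theta> = k"
      unfolding one_minus_sq_corr.simps using pq w0 k0 by (simp add: k)
    ultimately show "k \<in> one_minus_sq_corr ` {\<theta>. score_solution d \<theta>}"
      by (intro image_eqI[of _ _ ?\<theta>]) auto
  qed
qed

section \<open>Genericity\<close>

lemma poly_family_one: "poly_family 0 (\<lambda>d. 1)"
  using poly_family_const[OF polynomial_fun.const[of 1]] by (simp add: pCons_one)

lemma poly_family_numeral: "poly_family 0 (\<lambda>d. numeral b)"
  using poly_family_const[OF polynomial_fun.const[of "numeral b"]] by (simp add: numeral_poly)

lemmas poly_family_intros =
  poly_family_add poly_family_minus poly_family_uminus poly_family_mult poly_family_power
  poly_family_one poly_family_numeral

lemma polynomial_fun_poly_family:
  assumes "poly_family m F"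
  shows "polynomial_fun (\<lambda>d. poly (F d) c)"
proof -
  have "poly (F d) c = (\<Sum>i\<le>m. coeff (F d) i * c ^ i)" for d
    unfolding poly_altdef using assms
    by (intro sum.mono_neutral_left) (auto simp: poly_family_def coeff_eq_0)
  then show ?thesis using assms unfolding poly_family_def
    by (auto intro!: polynomial_fun_sum polynomial_fun.mult polynomial_fun.const)
qed

text \<open>Over the complex numbers a squarefree polynomial is the product of its distinct linear
  factors.\<close>
lemma card_roots_rsquarefree:
  fixes p :: "complex poly"
  assumes "rsquarefree p"
  shows "card {z. poly p z = 0} = degree p"
proof -
  have p: "p \<noteq> 0" using assms by (simp add: rsquarefree_def)
  have "degree p = degree (\<Prod>z | poly p z = 0. [:- z, 1:])"
    using p by (subst complex_poly_decompose_rsquarefree[OF assms, symmetric]) simp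
  also have "\<dots> = (\<Sum>z | poly p z = 0. degree [:- z, 1:])"
    by (rule degree_prod_sum_eq) simp
  finally show ?thesis by simp
qed

text \<open>The constructions above make sense over every commutative ring.  Over the polynomial ring, with
  the data as constants and \<open>k\<close> as the indeterminate, they yield the polynomials whose values they
  are over the field.\<close>
definition const_polys :: "('i \<Rightarrow> 'a::comm_ring_1) \<Rightarrow> 'i \<Rightarrow> 'a poly" where
  "const_polys d i = [:d i:]"

lemma poly_rows:
  "poly (mean_det n r s k) z = mean_det (poly n z) (poly r z) (poly s z) (poly k z)"
  "poly (row_own n r s c1 c2 v W k) z =
     row_own (poly n z) (poly r z) (poly s z) (poly c1 z) (poly c2 z) (poly v z) (poly W z) (poly k z)"
  "poly (row_cross n r s c2 v k) z =
     row_cross (poly n z) (poly r z) (poly s z) (poly c2 z) (poly v z) (poly k z)"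
  "poly (row_prod n r s c1 c2 k) z =
     row_prod (poly n z) (poly r z) (poly s z) (poly c1 z) (poly c2 z) (poly k z)"
  "poly (row_rhs n r s c1 c2 v11 v12 v22 W k) z =
     row_rhs (poly n z) (poly r z) (poly s z) (poly c1 z) (poly c2 z)
       (poly v11 z) (poly v12 z) (poly v22 z) (poly W z) (poly k z)"
  "poly (det3 a1 a2 a3 b1 b2 b3 e1 e2 e3) z =
     det3 (poly a1 z) (poly a2 z) (poly a3 z) (poly b1 z) (poly b2 z) (poly b3 z)
       (poly e1 z) (poly e2 z) (poly e3 z)"
  by (simp_all add: mean_det_def row_own_def row_cross_def row_prod_def row_rhs_def det3_def)

lemma poly_const_polys:
  "poly (const_polys d i) z = d i"
  "poly (gap1 (const_polys d)) z = gap1 d" "poly (gap2 (const_polys d)) z = gap2 d"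
  "poly (cov11 (const_polys d)) z = cov11 d" "poly (cov12 (const_polys d)) z = cov12 d"
  "poly (cov22 (const_polys d)) z = cov22 d"
  "poly (varZ (const_polys d)) z = varZ d" "poly (varW (const_polys d)) z = varW d"
  by (simp_all add: const_polys_def gap1_def gap2_def cov11_def cov12_def cov22_def varZ_def varW_def)

definition eliminant_poly :: "(stat \<Rightarrow> complex) \<Rightarrow> complex poly" where
  "eliminant_poly d = eliminant (const_polys d) [:0, 1:]"

lemma poly_cramer:
  "poly (cramer_den (const_polys d) [:0, 1:]) z = cramer_den d z"
  "poly (cramer_xi (const_polys d) [:0, 1:]) z = cramer_xi d z"
  "poly (cramer_eta (const_polys d) [:0, 1:]) z = cramer_eta d z"
  "poly (cramer_zeta (const_polys d) [:0, 1:]) z = cramer_zeta d z"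
  by (simp_all add: cramer_den_def cramer_xi_def cramer_eta_def cramer_zeta_def poly_rows poly_const_polys)

lemma poly_eliminant_poly: "poly (eliminant_poly d) z = eliminant d z"
  by (simp add: eliminant_poly_def eliminant_def poly_cramer)

lemma poly_cov_num: "poly (cov_num (const_polys d) [:0, 1:]) z = cov_num d z"
  by (simp add: cov_num_def poly_cramer poly_rows poly_const_polys)

lemma poly_family_const_polys: "poly_family 0 (\<lambda>d. const_polys d i)"
  unfolding const_polys_def by (intro poly_family_const polynomial_fun.coord)

lemma poly_family_data:
  "poly_family 0 (\<lambda>d. gap1 (const_polys d))"
  "poly_family 0 (\<lambda>d. gap2 (const_polys d))"
  "poly_family 0 (\<lambda>d. cov11 (const_polys d))"
  "poly_family 0 (\<lambda>d. cov12 (const_polys d))"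
  "poly_family 0 (\<lambda>d. cov22 (const_polys d))"
  "poly_family 0 (\<lambda>d. varZ (const_polys d))"
  "poly_family 0 (\<lambda>d. varW (const_polys d))"
proof -
  show "poly_family 0 (\<lambda>d. gap1 (const_polys d))" unfolding gap1_def
    by (rule poly_family_mono, (rule poly_family_intros poly_family_const_polys)+, simp)
  show "poly_family 0 (\<lambda>d. gap2 (const_polys d))" unfolding gap2_def
    by (rule poly_family_mono, (rule poly_family_intros poly_family_const_polys)+, simp)
  show "poly_family 0 (\<lambda>d. cov11 (const_polys d))" unfolding cov11_def
    by (rule poly_family_mono, (rule poly_family_intros poly_family_const_polys)+, simp)
  show "poly_family 0 (\<lambda>d. cov12 (const_polys d))" unfolding cov12_def
    by (rule poly_family_mono, (rule poly_family_intros poly_family_const_polys)+, simp)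
  show "poly_family 0 (\<lambda>d. cov22 (const_polys d))" unfolding cov22_def
    by (rule poly_family_mono, (rule poly_family_intros poly_family_const_polys)+, simp)
  show "poly_family 0 (\<lambda>d. varZ (const_polys d))" unfolding varZ_def
    by (rule poly_family_mono, (rule poly_family_intros poly_family_const_polys)+, simp)
  show "poly_family 0 (\<lambda>d. varW (const_polys d))" unfolding varW_def
    by (rule poly_family_mono, (rule poly_family_intros poly_family_const_polys)+, simp)
qed

lemma poly_family_mean_det:
  assumes "poly_family 0 n" "poly_family 0 r" "poly_family 0 s"
  shows "poly_family 1 (\<lambda>d. mean_det (n d) (r d) (s d) [:0, 1:])"
  unfolding mean_det_def
  by (rule poly_family_mono, (rule poly_family_intros poly_family_var assms)+, simp)

lemma poly_family_rows:
  assumes "poly_family 0 n" "poly_family 0 r" "poly_family 0 s" "poly_family 0 c1" "poly_family 0 c2"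
  shows "poly_family 0 v22 \<Longrightarrow> poly_family 0 W \<Longrightarrow>
      poly_family 2 (\<lambda>d. row_own (n d) (r d) (s d) (c1 d) (c2 d) (v22 d) (W d) [:0, 1:])"
    and "poly_family 0 v11 \<Longrightarrow>
      poly_family 1 (\<lambda>d. row_cross (n d) (r d) (s d) (c2 d) (v11 d) [:0, 1:])"
    and "poly_family 2 (\<lambda>d. row_prod (n d) (r d) (s d) (c1 d) (c2 d) [:0, 1:])"
    and "poly_family 0 v11 \<Longrightarrow> poly_family 0 v12 \<Longrightarrow> poly_family 0 v22 \<Longrightarrow> poly_family 0 W \<Longrightarrow>
      poly_family 1 (\<lambda>d. row_rhs (n d) (r d) (s d) (c1 d) (c2 d) (v11 d) (v12 d) (v22 d) (W d) [:0, 1:])"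
proof -
  note intros = poly_family_intros poly_family_var poly_family_mean_det assms
  show "poly_family 2 (\<lambda>d. row_own (n d) (r d) (s d) (c1 d) (c2 d) (v22 d) (W d) [:0, 1:])"
    if "poly_family 0 v22" "poly_family 0 W"
    unfolding row_own_def by (rule poly_family_mono, (rule intros that)+, simp)
  show "poly_family 1 (\<lambda>d. row_cross (n d) (r d) (s d) (c2 d) (v11 d) [:0, 1:])"
    if "poly_family 0 v11"
    unfolding row_cross_def by (rule poly_family_mono, (rule intros that)+, simp)
  show "poly_family 2 (\<lambda>d. row_prod (n d) (r d) (s d) (c1 d) (c2 d) [:0, 1:])"
    unfolding row_prod_def by (rule poly_family_mono, (rule intros)+, simp)
  show "poly_family 1 (\<lambda>d. row_rhs (n d) (r d) (s d) (c1 d) (c2 d) (v11 d) (v12 d) (v22 d) (W d) [:0, 1:])"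
    if "poly_family 0 v11" "poly_family 0 v12" "poly_family 0 v22" "poly_family 0 W"
    unfolding row_rhs_def by (rule poly_family_mono, (rule intros that)+, simp)
qed

lemma poly_family_det3:
  assumes "poly_family a1 A1" "poly_family a2 A2" "poly_family a3 A3"
    "poly_family b1 B1" "poly_family b2 B2" "poly_family b3 B3"
    "poly_family e1 E1" "poly_family e2 E2" "poly_family e3 E3"
    and "a1 + b2 + e3 \<le> m" "a1 + b3 + e2 \<le> m" "a2 + b1 + e3 \<le> m"
      "a2 + b3 + e1 \<le> m" "a3 + b1 + e2 \<le> m" "a3 + b2 + e1 \<le> m"
  shows "poly_family m (\<lambda>d. det3 (A1 d) (A2 d) (A3 d) (B1 d) (B2 d) (B3 d) (E1 d) (E2 d) (E3 d))"
  unfolding det3_def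
  by (rule poly_family_mono, (rule poly_family_intros assms(1-9))+) (use assms(10-15) in auto)

text \<open>The entries of the linear system have degrees at most \<open>(0,0,1)\<close>, \<open>(2,1,2)\<close>, \<open>(1,2,2)\<close> in
  the three rows and at most \<open>0\<close>, \<open>1\<close>, \<open>1\<close> on the right-hand side.\<close>
lemma poly_family_cramer:
  "poly_family 5 (\<lambda>d. cramer_den (const_polys d) [:0, 1:])"
  "poly_family 4 (\<lambda>d. cramer_xi (const_polys d) [:0, 1:])"
  "poly_family 4 (\<lambda>d. cramer_eta (const_polys d) [:0, 1:])"
  "poly_family 4 (\<lambda>d. cramer_zeta (const_polys d) [:0, 1:])"
proof -
  note intros = poly_family_rows poly_family_mean_det poly_family_data poly_family_const_polys
      poly_family_intros
  show "poly_family 5 (\<lambda>d. cramer_den (const_polys d) [:0, 1:])" unfolding cramer_den_def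
    by (rule poly_family_det3, (rule intros)+) simp_all
  show "poly_family 4 (\<lambda>d. cramer_xi (const_polys d) [:0, 1:])" unfolding cramer_xi_def
    by (rule poly_family_det3, (rule intros)+) simp_all
  show "poly_family 4 (\<lambda>d. cramer_eta (const_polys d) [:0, 1:])" unfolding cramer_eta_def
    by (rule poly_family_det3, (rule intros)+) simp_all
  show "poly_family 4 (\<lambda>d. cramer_zeta (const_polys d) [:0, 1:])" unfolding cramer_zeta_def
    by (rule poly_family_det3, (rule intros)+) simp_all
qed

lemma poly_family_eliminant: "poly_family 9 eliminant_poly"
proof -
  have "poly_family 9 (\<lambda>d. eliminant_poly d)"
    unfolding eliminant_poly_def eliminant_def
    by (rule poly_family_mono, (rule poly_family_intros poly_family_cramer)+, simp)
  then show ?thesis by simp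
qed

lemma poly_family_cov_num: "poly_family 6 (\<lambda>d. cov_num (const_polys d) [:0, 1:])"
  unfolding cov_num_def
  by (rule poly_family_mono, (rule poly_family_intros poly_family_cramer poly_family_data
      poly_family_const_polys poly_family_mean_det poly_family_var)+, simp)

text \<open>A single point at which every genericity condition can be verified by exact arithmetic.  It need
  not come from a sample; negative sizes with \<open>n + r = n + s = 1\<close> keep the coefficients small.\<close>
fun sample_point :: "stat \<Rightarrow> complex" where
  "sample_point Size_n = 3" | "sample_point Size_r = -2" | "sample_point Size_s = -2"
| "sample_point Mean_Y1 = 0" | "sample_point Mean_Y2 = 0" | "sample_point Mean_Y1Y1 = -1"
| "sample_point Mean_Y1Y2 = 2" | "sample_point Mean_Y2Y2 = -1"
| "sample_point Mean_Z = 1" | "sample_point Mean_ZZ = 4"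
| "sample_point Mean_W = 1" | "sample_point Mean_WW = -2"

lemma sample_point_data:
  "gap1 sample_point = 1" "gap2 sample_point = 1" "cov11 sample_point = -1" "cov12 sample_point = 2"
  "cov22 sample_point = -1" "varZ sample_point = 3" "varW sample_point = -3"
  by (simp_all add: gap1_def gap2_def cov11_def cov12_def cov22_def varZ_def varW_def)

lemma sample_point_const_polys:
  "const_polys sample_point Size_n = [:3:]" "const_polys sample_point Size_r = [:-2:]"
  "const_polys sample_point Size_s = [:-2:]"
  "gap1 (const_polys sample_point) = [:1:]" "gap2 (const_polys sample_point) = [:1:]"
  "cov11 (const_polys sample_point) = [:-1:]" "cov12 (const_polys sample_point) = [:2:]"
  "cov22 (const_polys sample_point) = [:-1:]"
  "varZ (const_polys sample_point) = [:3:]" "varW (const_polys sample_point) = [:-3:]"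
  by (simp_all add: const_polys_def gap1_def gap2_def cov11_def cov12_def cov22_def varZ_def varW_def
      power2_eq_square)

lemma sample_point_cramer:
  "cramer_den (const_polys sample_point) [:0, 1:] = [:81, -540, 0, 3456, -5184, 2304:]"
  "cramer_xi (const_polys sample_point) [:0, 1:] = [:81, -432, 288, 576, -576:]"
  "cramer_eta (const_polys sample_point) [:0, 1:] = [:81, -864, 3168, -4032, 1728:]"
  "cramer_zeta (const_polys sample_point) [:0, 1:] = [:-27, 216, -864, 1152, -576:]"
  unfolding cramer_den_def cramer_xi_def cramer_eta_def cramer_zeta_def sample_point_const_polys
    row_own_def row_cross_def row_prod_def row_rhs_def mean_det_def det3_def
  by (simp_all add: power2_eq_square numeral_poly one_pCons)

lemma sample_point_eliminant: "eliminant_poly sample_point =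
    [:8748, -137052, 839808, -2363904, 2032128, 4271616, -12607488, 13271040, -6635520, 1327104:]"
  unfolding eliminant_poly_def eliminant_def sample_point_cramer by simp

lemma sample_point_cov_num: "cov_num (const_polys sample_point) [:0, 1:] =
    [:0, -1944, 27216, -93312, 138240, -96768, 27648:]"
  unfolding cov_num_def sample_point_cramer sample_point_const_polys mean_det_def
  by (simp add: power2_eq_square numeral_poly one_pCons)

text \<open>At this point the eliminant has no common root with the Cramer denominator, with the numerator
  of the covariance, or with its own derivative.  The cofactors come from the extended Euclidean
  algorithm, with denominators cleared.\<close>
lemma sample_point_bezout:
  "[:-8601, 9756, 50136, -93792, 45568:] * eliminant_poly sample_point +
   [:921132, -9465660, 37163232, -48748896, -45098496, 203238144, -238141440, 126203904, -26247168:]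
     * cramer_den (const_polys sample_point) [:0, 1:] = [:-629856:]"
  "[:180, 15354, -52812, 65360, -36320, 7168:] * eliminant_poly sample_point +
   [:56403, -452709, 1386144, -921480, -2942592, 6633024, -5666304, 2259456, -344064:]
     * cov_num (const_polys sample_point) [:0, 1:] = [:1574640:]"
  "[:2422532031, -17457096096, 33016218968, 33666025792, -199514695872, 278925419008, -171437653504, 40605990912:]
     * eliminant_poly sample_point +
   [:155050515, -1636621215, 6328611192, -8181257240, -7705424384, 34425709760, -40460265472, 21555170816, -4511776768:]
     * pderiv (eliminant_poly sample_point) = [:-57672974592:]"
  unfolding sample_point_cramer sample_point_eliminant sample_point_cov_num
  by (simp_all add: pderiv_pCons)

text \<open>All genericity conditions combined into one polynomial: the conditions of the elimination, the
  leading coefficient and squarefreeness of the eliminant, which make it have exactly nine roots, and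
  nondegeneracy of the sample variances, which real data need.\<close>
lemma generic_polynomial:
  obtains \<Psi> :: "(stat \<Rightarrow> complex) \<Rightarrow> complex" where "polynomial_fun \<Psi>" "\<Psi> sample_point \<noteq> 0"
    "\<And>d. \<Psi> d \<noteq> 0 \<Longrightarrow> generic_data d"
    "\<And>d. \<Psi> d \<noteq> 0 \<Longrightarrow> card {k. eliminant d k = 0} = 9"
    "\<And>d. \<Psi> d \<noteq> 0 \<Longrightarrow> cov11 d * cov22 d - (cov12 d)\<^sup>2 \<noteq> 0 \<and> varZ d \<noteq> 0 \<and> varW d \<noteq> 0"
proof -
  have deg: "degree (eliminant_poly sample_point) = 9" by (simp add: sample_point_eliminant)
  obtain \<rho>1 where \<rho>1: "polynomial_fun \<rho>1" "\<rho>1 sample_point \<noteq> 0"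
    "\<And>d z. \<rho>1 d \<noteq> 0 \<Longrightarrow> poly (eliminant_poly d) z = 0 \<Longrightarrow> poly (cramer_den (const_polys d) [:0, 1:]) z \<noteq> 0"
    by (rule generic_no_common_root[where F = eliminant_poly and G = "\<lambda>d. cramer_den (const_polys d) [:0, 1:]"
          and ?d0.0 = sample_point, OF poly_family_eliminant poly_family_cramer(1) deg sample_point_bezout(1)]) simp_all
  obtain \<rho>2 where \<rho>2: "polynomial_fun \<rho>2" "\<rho>2 sample_point \<noteq> 0"
    "\<And>d z. \<rho>2 d \<noteq> 0 \<Longrightarrow> poly (eliminant_poly d) z = 0 \<Longrightarrow> poly (cov_num (const_polys d) [:0, 1:]) z \<noteq> 0"
    by (rule generic_no_common_root[where F = eliminant_poly and G = "\<lambda>d. cov_num (const_polys d) [:0, 1:]"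
          and ?d0.0 = sample_point, OF poly_family_eliminant poly_family_cov_num deg sample_point_bezout(2)]) simp_all
  obtain \<rho>3 where \<rho>3: "polynomial_fun \<rho>3" "\<rho>3 sample_point \<noteq> 0"
    "\<And>d z. \<rho>3 d \<noteq> 0 \<Longrightarrow> poly (eliminant_poly d) z = 0 \<Longrightarrow> poly (pderiv (eliminant_poly d)) z \<noteq> 0"
    by (rule generic_no_common_root[where F = eliminant_poly and G = "\<lambda>d. pderiv (eliminant_poly d)"
          and ?d0.0 = sample_point, OF poly_family_eliminant poly_family_pderiv[OF poly_family_eliminant]
          deg sample_point_bezout(3)]) simp_all
  define \<Psi> where "\<Psi> d = d Size_n * d Size_r * d Size_s * gap1 d * gap2 d
    * ((d Size_n + d Size_r) * (d Size_n + d Size_s) * cov12 d + d Size_r * d Size_s * gap1 d * gap2 d)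
    * poly (eliminant_poly d) 0 * poly (eliminant_poly d) 1 * coeff (eliminant_poly d) 9
    * \<rho>1 d * \<rho>2 d * \<rho>3 d
    * (cov11 d * cov22 d - (cov12 d)\<^sup>2) * varZ d * varW d" for d
  show ?thesis
  proof (rule that[of \<Psi>])
    have data: "polynomial_fun (\<lambda>d. gap1 d :: complex)" "polynomial_fun (\<lambda>d. gap2 d :: complex)"
      "polynomial_fun (\<lambda>d. cov11 d :: complex)" "polynomial_fun (\<lambda>d. cov12 d :: complex)"
      "polynomial_fun (\<lambda>d. cov22 d :: complex)"
      "polynomial_fun (\<lambda>d. varZ d :: complex)" "polynomial_fun (\<lambda>d. varW d :: complex)"
      using polynomial_fun_poly_family[OF poly_family_data(1)] polynomial_fun_poly_family[OF poly_family_data(2)]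
        polynomial_fun_poly_family[OF poly_family_data(3)] polynomial_fun_poly_family[OF poly_family_data(4)]
        polynomial_fun_poly_family[OF poly_family_data(5)] polynomial_fun_poly_family[OF poly_family_data(6)]
        polynomial_fun_poly_family[OF poly_family_data(7)]
      by (simp_all add: poly_const_polys)
    have coeff: "polynomial_fun (\<lambda>d. coeff (eliminant_poly d) 9)"
      using poly_family_eliminant by (simp add: poly_family_def)
    show "polynomial_fun \<Psi>" unfolding \<Psi>_def[abs_def]
      by (intro polynomial_fun.mult polynomial_fun.add polynomial_fun_minus polynomial_fun_power
          polynomial_fun.coord data coeff \<rho>1(1) \<rho>2(1) \<rho>3(1)
          polynomial_fun_poly_family[OF poly_family_eliminant])
    show "\<Psi> sample_point \<noteq> 0"
      using \<rho>1(2) \<rho>2(2) \<rho>3(2)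
      by (simp add: \<Psi>_def sample_point_data sample_point_eliminant coeff_pCons numeral_eq_Suc)
  next
    fix d assume "\<Psi> d \<noteq> 0"
    then have nz: "d Size_n \<noteq> 0" "d Size_r \<noteq> 0" "d Size_s \<noteq> 0" "gap1 d \<noteq> 0" "gap2 d \<noteq> 0"
      "(d Size_n + d Size_r) * (d Size_n + d Size_s) * cov12 d + d Size_r * d Size_s * gap1 d * gap2 d \<noteq> 0"
      "eliminant d 0 \<noteq> 0" "eliminant d 1 \<noteq> 0" "coeff (eliminant_poly d) 9 \<noteq> 0"
      "\<rho>1 d \<noteq> 0" "\<rho>2 d \<noteq> 0" "\<rho>3 d \<noteq> 0"
      and real: "cov11 d * cov22 d - (cov12 d)\<^sup>2 \<noteq> 0" "varZ d \<noteq> 0" "varW d \<noteq> 0"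
      by (auto simp: \<Psi>_def poly_eliminant_poly)
    show "cov11 d * cov22 d - (cov12 d)\<^sup>2 \<noteq> 0 \<and> varZ d \<noteq> 0 \<and> varW d \<noteq> 0" using real by blast
    show "generic_data d"
      using nz \<rho>1(3)[OF nz(10)] \<rho>2(3)[OF nz(11)] unfolding generic_data_def
      by (simp add: poly_eliminant_poly poly_cramer poly_cov_num)
    have "rsquarefree (eliminant_poly d)"
      using \<rho>3(3)[OF nz(12)] by (auto simp: rsquarefree_roots)
    then have "card {k. poly (eliminant_poly d) k = 0} = degree (eliminant_poly d)"
      by (rule card_roots_rsquarefree)
    also have "\<dots> = 9"
      using nz(9) poly_family_eliminant le_degree[of "eliminant_poly d" 9]
      by (auto simp: poly_family_def intro: antisym)
    finally show "card {k. eliminant d k = 0} = 9" by (simp add: poly_eliminant_poly)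
  qed
qed

lemma zero_set_algebraic: "polynomial_fun f \<Longrightarrow> algebraic_subset {x. f x = 0}"
  unfolding algebraic_subset_def by (rule exI[of _ "{f}"]) simp

section \<open>The maximum of the real log-likelihood\<close>

lemma average_covariance:
  assumes "m > 0"
  shows "average m (\<lambda>j. f j * g j) - average m f * average m g =
    (\<Sum>j=1..m. (f j - average m f) * (g j - average m g)) / real m"
proof -
  have sums: "(\<Sum>j=1..m. f j) = real m * average m f" "(\<Sum>j=1..m. g j) = real m * average m g"
    using assms by (simp_all add: average_def)
  have "(\<Sum>j=1..m. (f j - average m f) * (g j - average m g)) =
     (\<Sum>j=1..m. f j * g j) - average m g * (\<Sum>j=1..m. f j) - average m f * (\<Sum>j=1..m. g j)
       + real m * (average m f * average m g)"
    by (simp add: algebra_simps sum.distrib sum_subtractf sum_distrib_left)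
  also have "\<dots> = (\<Sum>j=1..m. f j * g j) - real m * (average m f * average m g)"
    unfolding sums by (simp add: algebra_simps)
  finally show ?thesis using assms by (simp add: average_def[of m "\<lambda>j. f j * g j"] diff_divide_distrib)
qed

lemma sample_variance_nonneg:
  assumes "m > 0" shows "average m (\<lambda>j. (f j)\<^sup>2) - (average m f)\<^sup>2 \<ge> 0"
  using average_covariance[OF assms, of f f] by (simp add: power2_eq_square sum_nonneg)

lemma sample_cov_Cauchy_Schwarz:
  assumes "m > 0"
  shows "(average m (\<lambda>j. f j * g j) - average m f * average m g)\<^sup>2 \<le>
    (average m (\<lambda>j. (f j)\<^sup>2) - (average m f)\<^sup>2) * (average m (\<lambda>j. (g j)\<^sup>2) - (average m g)\<^sup>2)"
proof -
  have "(\<Sum>j=1..m. (f j - average m f) * (g j - average m g))\<^sup>2 \<le>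
     (\<Sum>j=1..m. (f j - average m f)\<^sup>2) * (\<Sum>j=1..m. (g j - average m g)\<^sup>2)"
    by (rule Cauchy_Schwarz_ineq_sum)
  then have "((\<Sum>j=1..m. (f j - average m f) * (g j - average m g)) / real m)\<^sup>2 \<le>
     (\<Sum>j=1..m. (f j - average m f)\<^sup>2) / real m * ((\<Sum>j=1..m. (g j - average m g)\<^sup>2) / real m)"
    using assms by (simp add: power_divide power2_eq_square[of "real m"] divide_right_mono)
  then show ?thesis
    using average_covariance[OF assms, of f g] average_covariance[OF assms, of f f]
      average_covariance[OF assms, of g g] by (simp add: power2_eq_square)
qed

lemma param_space_iff:
  "(m1, m2, g11, g12, g22) \<in> param_space \<longleftrightarrow> g11 > 0 \<and> g11 * g22 - g12 * g12 > 0"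
proof -
  let ?A = "conc_matrix g11 g12 g22"
  have sym: "transpose ?A = ?A"
    by (simp add: conc_matrix_def Finite_Cartesian_Product.vec_eq_iff forall_2 transpose_def)
  have form: "x \<bullet> (?A *v x) = g11 * (x$1)\<^sup>2 + 2 * g12 * x$1 * x$2 + g22 * (x$2)\<^sup>2" for x
    by (simp add: conc_matrix_def inner_vec_def matrix_vector_mult_def sum_2 power2_eq_square algebra_simps)
  have "(\<forall>x::real^2. x \<noteq> 0 \<longrightarrow> x \<bullet> (?A *v x) > 0) \<longleftrightarrow> g11 > 0 \<and> g11 * g22 - g12 * g12 > 0"
  proof
    assume pos: "\<forall>x::real^2. x \<noteq> 0 \<longrightarrow> x \<bullet> (?A *v x) > 0"
    have "(vector [1, 0] :: real^2) \<noteq> 0" by (simp add: Finite_Cartesian_Product.vec_eq_iff forall_2)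
    then have g11: "g11 > 0" using pos form[of "vector [1, 0]"] by fastforce
    have "(vector [- g12, g11] :: real^2) \<noteq> 0" using g11 by (simp add: Finite_Cartesian_Product.vec_eq_iff forall_2)
    then have "0 < g11 * (g11 * g22 - g12 * g12)"
      using pos form[of "vector [- g12, g11]"] by (fastforce simp: power2_eq_square algebra_simps)
    then show "g11 > 0 \<and> g11 * g22 - g12 * g12 > 0" using g11 by (simp add: zero_less_mult_iff)
  next
    assume g: "g11 > 0 \<and> g11 * g22 - g12 * g12 > 0"
    show "\<forall>x::real^2. x \<noteq> 0 \<longrightarrow> x \<bullet> (?A *v x) > 0"
    proof (intro allI impI)
      fix x :: "real^2" assume "x \<noteq> 0"
      then have x: "x$1 \<noteq> 0 \<or> x$2 \<noteq> 0" by (simp add: Finite_Cartesian_Product.vec_eq_iff forall_2)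
      have "g11 * (x \<bullet> (?A *v x)) = (g11 * x$1 + g12 * x$2)\<^sup>2 + (g11 * g22 - g12 * g12) * (x$2)\<^sup>2"
        unfolding form by (simp add: power2_eq_square algebra_simps)
      also have "\<dots> > 0"
      proof (cases "x$2 = 0")
        case True
        then show ?thesis using x g by simp
      next
        case False
        then show ?thesis using g by (intro add_nonneg_pos mult_pos_pos) auto
      qed
      finally show "x \<bullet> (?A *v x) > 0" using g by (simp add: zero_less_mult_iff)
    qed
  qed
  then show ?thesis using sym by (simp add: param_space_def PD_def)
qed

text \<open>The smallest eigenvalue is at least determinant over trace; by Cayley--Hamilton the difference,
  multiplied by the trace, is the squared norm of the image vector.\<close>
lemma pd2_quadratic_lower:
  fixes a b c x y :: real
  assumes "a + c > 0"
  shows "(a * c - b * b) / (a + c) * (x\<^sup>2 + y\<^sup>2) \<le> a * x\<^sup>2 + 2 * b * x * y + c * y\<^sup>2"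
proof -
  have "(a + c) * (a * x\<^sup>2 + 2 * b * x * y + c * y\<^sup>2) - (a * c - b * b) * (x\<^sup>2 + y\<^sup>2)
      = (a * x + b * y)\<^sup>2 + (b * x + c * y)\<^sup>2"
    by (simp add: power2_eq_square algebra_simps)
  moreover have "(a * x + b * y)\<^sup>2 + (b * x + c * y)\<^sup>2 \<ge> 0" by simp
  ultimately have "(a * c - b * b) * (x\<^sup>2 + y\<^sup>2) \<le> (a + c) * (a * x\<^sup>2 + 2 * b * x * y + c * y\<^sup>2)"
    by linarith
  then show ?thesis using assms by (simp add: field_simps)
qed

text \<open>The same identity with \<open>(x\<^sup>2, x y, y\<^sup>2)\<close> replaced by the entries of a positive semidefinite
  matrix.\<close>
lemma pd2_trace_lower:
  fixes v11 v12 v22 g11 g12 g22 :: real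
  assumes v: "v11 + v22 > 0" and g: "g11 + g22 > 0" "g11 * g22 - g12 * g12 \<ge> 0"
  shows "(v11 * v22 - v12 * v12) / (v11 + v22) * (g11 + g22) \<le> v11 * g11 + 2 * v12 * g12 + v22 * g22"
proof -
  have psd: "0 \<le> g11 * x\<^sup>2 + 2 * g12 * x * y + g22 * y\<^sup>2" for x y
  proof -
    have "0 \<le> (g11 * g22 - g12 * g12) / (g11 + g22) * (x\<^sup>2 + y\<^sup>2)" using g by simp
    also have "\<dots> \<le> g11 * x\<^sup>2 + 2 * g12 * x * y + g22 * y\<^sup>2" by (rule pd2_quadratic_lower[OF g(1)])
    finally show ?thesis .
  qed
  have "(v11 + v22) * (v11 * g11 + 2 * v12 * g12 + v22 * g22) - (v11 * v22 - v12 * v12) * (g11 + g22) =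
     (g11 * v11\<^sup>2 + 2 * g12 * v11 * v12 + g22 * v12\<^sup>2) + (g11 * v12\<^sup>2 + 2 * g12 * v12 * v22 + g22 * v22\<^sup>2)"
    by (simp add: power2_eq_square algebra_simps)
  then have "(v11 * v22 - v12 * v12) * (g11 + g22) \<le> (v11 + v22) * (v11 * g11 + 2 * v12 * g12 + v22 * g22)"
    using psd[of v11 v12] psd[of v12 v22] by linarith
  then show ?thesis using v by (simp add: field_simps)
qed

lemma ln_minus_linear_le:
  fixes a T V :: real
  assumes "a > 0" "0 < V" "V \<le> T"
  shows "ln a - a * T \<le> - 1 - ln V"
proof -
  have "ln (a * V) \<le> a * V - 1" using assms by (intro ln_le_minus_one) simp
  moreover have "a * V \<le> a * T" using assms by simp
  ultimately show ?thesis using assms ln_mult_pos[of a V] by linarith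
qed

text \<open>The incomplete observations contribute a bounded amount, since \<open>ln a - a T\<close> is bounded above.
  For the complete observations the two bounds in terms of determinant and trace leave only
  \<open>det \<Gamma>\<close>, the trace of \<open>\<Gamma>\<close> and the distance of the mean from the sample mean.\<close>
lemma loglik_upper_bound:
  fixes d :: "stat \<Rightarrow> real"
  assumes n: "d Size_n > 0" "d Size_r > 0" "d Size_s > 0"
    and V: "cov11 d + cov22 d > 0" and Z: "varZ d > 0" and W: "varW d > 0"
    and g: "g11 > 0" "g11 * g22 - g12 * g12 > 0"
  defines "D \<equiv> g11 * g22 - g12 * g12"
  shows "loglik ln d (m1, m2, g11, g12, g22) \<le>
    d Size_n / 2 * (ln D
      - (cov11 d * cov22 d - cov12 d * cov12 d) / (cov11 d + cov22 d) * (g11 + g22)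
      - D / (g11 + g22) * ((d Mean_Y1 - m1)\<^sup>2 + (d Mean_Y2 - m2)\<^sup>2))
    + d Size_r / 2 * (- 1 - ln (varZ d)) + d Size_s / 2 * (- 1 - ln (varW d))"
proof -
  define e f where "e = d Mean_Y1 - m1" and "f = d Mean_Y2 - m2"
  have "g11 * g22 > 0" using g(2) by (meson add_strict_increasing2 diff_gt_0_iff_gt le_less_trans zero_le_square)
  then have g22: "g22 > 0" using g(1) by (simp add: zero_less_mult_iff)
  have D: "D > 0" using g by (simp add: D_def)
  have tau: "g11 + g22 > 0" using g(1) g22 by simp
  have "loglik ln d (m1, m2, g11, g12, g22) =
    d Size_n / 2 * (ln D - (cov11 d * g11 + 2 * cov12 d * g12 + cov22 d * g22)
      - (g11 * e\<^sup>2 + 2 * g12 * e * f + g22 * f\<^sup>2))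
    + d Size_r / 2 * (ln (D / g22) - D / g22 * (varZ d + (d Mean_Z - m1)\<^sup>2))
    + d Size_s / 2 * (ln (D / g11) - D / g11 * (varW d + (d Mean_W - m2)\<^sup>2))"
    unfolding loglik_centred D_def[symmetric] e_def[symmetric] f_def[symmetric]
      ln_divide_pos[OF D g22] ln_divide_pos[OF D g(1)]
    by (simp add: algebra_simps add_divide_distrib diff_divide_distrib)
  moreover have "d Size_n / 2 * (ln D - (cov11 d * g11 + 2 * cov12 d * g12 + cov22 d * g22)
      - (g11 * e\<^sup>2 + 2 * g12 * e * f + g22 * f\<^sup>2)) \<le>
    d Size_n / 2 * (ln D
      - (cov11 d * cov22 d - cov12 d * cov12 d) / (cov11 d + cov22 d) * (g11 + g22)
      - D / (g11 + g22) * (e\<^sup>2 + f\<^sup>2))"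
    using n(1) pd2_trace_lower[OF V tau, of g12 "cov12 d"] pd2_quadratic_lower[OF tau, of g12 e f] D
    unfolding D_def by (intro mult_left_mono diff_mono) auto
  moreover have "d Size_r / 2 * (ln (D / g22) - D / g22 * (varZ d + (d Mean_Z - m1)\<^sup>2)) \<le>
      d Size_r / 2 * (- 1 - ln (varZ d))"
    using n D g22 Z by (intro mult_left_mono ln_minus_linear_le) auto
  moreover have "d Size_s / 2 * (ln (D / g11) - D / g11 * (varW d + (d Mean_W - m2)\<^sup>2)) \<le>
      d Size_s / 2 * (- 1 - ln (varW d))"
    using n D g W by (intro mult_left_mono ln_minus_linear_le) auto
  ultimately show ?thesis unfolding e_def f_def by linarith
qed

lemma ln_linear_coercive:
  fixes lam c :: real
  assumes lam: "lam > 0"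
  obtains M where "M > 0" "\<And>\<tau>. \<tau> > 0 \<Longrightarrow> c \<le> 2 * ln \<tau> - lam * \<tau> \<Longrightarrow> \<tau> \<le> M"
proof
  define M where "M = max 1 (2 / lam * (- 2 - 2 * ln (lam / 4) - c))"
  show "M > 0" by (simp add: M_def)
  fix \<tau> :: real assume tau: "\<tau> > 0" and c: "c \<le> 2 * ln \<tau> - lam * \<tau>"
  have "ln (\<tau> * (lam / 4)) \<le> \<tau> * (lam / 4) - 1" using tau lam by (intro ln_le_minus_one) simp
  then have "ln \<tau> + ln (lam / 4) \<le> \<tau> * (lam / 4) - 1" using tau lam ln_mult_pos[of \<tau> "lam / 4"] by simp
  then have "lam / 2 * \<tau> \<le> - 2 - 2 * ln (lam / 4) - c" using c by (simp add: algebra_simps)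
  then have "\<tau> \<le> 2 / lam * (- 2 - 2 * ln (lam / 4) - c)" using lam by (simp add: field_simps)
  then show "\<tau> \<le> M" by (simp add: M_def)
qed

text \<open>The log-likelihood tends to minus infinity at the boundary of the parameter space: on a
  superlevel set, \<open>det \<Gamma>\<close> stays away from zero, and the trace of \<open>\<Gamma>\<close> and the mean stay bounded.\<close>
lemma loglik_superlevel_bounded:
  fixes d :: "stat \<Rightarrow> real"
  assumes n: "d Size_n > 0" "d Size_r > 0" "d Size_s > 0"
    and V: "cov11 d + cov22 d > 0" "cov11 d * cov22 d - cov12 d * cov12 d > 0"
    and Z: "varZ d > 0" and W: "varW d > 0"
  obtains \<delta> M B where "\<delta> > 0"
    "\<And>m1 m2 g11 g12 g22. (m1, m2, g11, g12, g22) \<in> param_space \<Longrightarrow>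
       c \<le> loglik ln d (m1, m2, g11, g12, g22) \<Longrightarrow>
       \<delta> \<le> g11 * g22 - g12 * g12 \<and> g11 + g22 \<le> M \<and> (d Mean_Y1 - m1)\<^sup>2 + (d Mean_Y2 - m2)\<^sup>2 \<le> B"
proof -
  define lam where "lam = (cov11 d * cov22 d - cov12 d * cov12 d) / (cov11 d + cov22 d)"
  have lam: "lam > 0" using V by (simp add: lam_def)
  define C where "C = d Size_r / 2 * (- 1 - ln (varZ d)) + d Size_s / 2 * (- 1 - ln (varW d))"
  define c' where "c' = 2 / d Size_n * (c - C)"
  obtain M where M: "M > 0" "\<And>\<tau>. \<tau> > 0 \<Longrightarrow> c' \<le> 2 * ln \<tau> - lam * \<tau> \<Longrightarrow> \<tau> \<le> M"
    using ln_linear_coercive[OF lam] by metis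
  show ?thesis
  proof (rule that[of "exp c'" M "(2 * M - c') * M / exp c'"])
    fix m1 m2 g11 g12 g22
    assume \<theta>: "(m1, m2, g11, g12, g22) \<in> param_space"
      and c: "c \<le> loglik ln d (m1, m2, g11, g12, g22)"
    define D where "D = g11 * g22 - g12 * g12"
    define \<tau> where "\<tau> = g11 + g22"
    define E where "E = (d Mean_Y1 - m1)\<^sup>2 + (d Mean_Y2 - m2)\<^sup>2"
    have g: "g11 > 0" "g11 * g22 - g12 * g12 > 0" using \<theta> by (auto simp: param_space_iff)
    then have D: "D > 0" by (simp add: D_def)
    have "g11 * g22 > 0" using g(2) zero_le_square[of g12] by linarith
    then have g22: "g22 > 0" using g(1) by (simp add: zero_less_mult_iff)
    have tau: "\<tau> > 0" using g(1) g22 by (simp add: \<tau>_def)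
    have E: "E \<ge> 0" by (simp add: E_def)
    have "c \<le> d Size_n / 2 * (ln D - lam * \<tau> - D / \<tau> * E) + C"
      using c loglik_upper_bound[OF n V(1) Z W g, of m1 m2]
      unfolding D_def[symmetric] \<tau>_def[symmetric] E_def[symmetric] lam_def[symmetric] C_def by linarith
    then have main: "c' \<le> ln D - lam * \<tau> - D / \<tau> * E"
      using n(1) by (simp add: c'_def field_simps)
    have lt: "lam * \<tau> \<ge> 0" and DE: "D / \<tau> * E \<ge> 0" using lam tau D E by simp_all
    \<comment> \<open>The terms subtracted from \<open>ln D\<close> are nonnegative, so \<open>ln D\<close> alone reaches the level; as it
      grows at most logarithmically in the trace, the linear term then bounds the trace.\<close>
    have "c' \<le> ln D" using main lt DE by linarith
    then have delta: "exp c' \<le> D" using D by (simp add: ln_ge_iff)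
    have "D \<le> g11 * g22" by (simp add: D_def)
    also have "\<dots> \<le> \<tau> * \<tau>" unfolding \<tau>_def using g(1) g22 by (intro mult_mono) auto
    finally have "ln D \<le> ln (\<tau> * \<tau>)" using D tau by simp
    then have lnD: "ln D \<le> 2 * ln \<tau>" using tau by (simp add: ln_mult_pos)
    have tauM: "\<tau> \<le> M" using M(2)[OF tau] main lnD DE by linarith
    have "D / \<tau> * E \<le> 2 * ln \<tau> - c'" using main lnD lt by linarith
    also have "\<dots> \<le> 2 * M - c'" using ln_le_minus_one[OF tau] tauM by linarith
    finally have "D * E \<le> (2 * M - c') * \<tau>" using tau by (simp add: field_simps)
    also have "\<dots> \<le> (2 * M - c') * M"
    proof (rule mult_left_mono[OF tauM])
      show "0 \<le> 2 * M - c'" using \<open>D / \<tau> * E \<le> 2 * ln \<tau> - c'\<close> \<open>2 * ln \<tau> - c' \<le> 2 * M - c'\<close> DE by linarith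
    qed
    finally have "exp c' * E \<le> (2 * M - c') * M"
      using mult_right_mono[OF delta E] by linarith
    then have "E \<le> (2 * M - c') * M / exp c'" by (simp add: field_simps)
    then show "exp c' \<le> g11 * g22 - g12 * g12 \<and> g11 + g22 \<le> M \<and>
        (d Mean_Y1 - m1)\<^sup>2 + (d Mean_Y2 - m2)\<^sup>2 \<le> (2 * M - c') * M / exp c'"
      using delta tauM by (simp add: D_def \<tau>_def E_def)
  qed simp
qed

lemma compact_parameter_region:
  fixes a1 a2 \<delta> M B :: real
  assumes "\<delta> > 0"
  defines "K \<equiv> {\<theta>::real param. case \<theta> of (m1, m2, g11, g12, g22) \<Rightarrow>
     0 \<le> g11 \<and> 0 \<le> g22 \<and> \<delta> \<le> g11 * g22 - g12 * g12 \<and> g11 + g22 \<le> M \<and> (a1 - m1)\<^sup>2 + (a2 - m2)\<^sup>2 \<le> B}"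
  shows "compact K"
proof -
  define box where "box = {a1 - (B + 1)..a1 + (B + 1)} \<times> {a2 - (B + 1)..a2 + (B + 1)} \<times> {0..M} \<times> {- M..M} \<times> {0..M}"
  have abs_le: "\<bar>x\<bar> \<le> B + 1" if "x\<^sup>2 \<le> B" for x :: real
  proof -
    \<comment> \<open>The crude bound \<open>B + 1\<close> for a number with square at most \<open>B\<close> avoids square roots.\<close>
    have "0 \<le> (\<bar>x\<bar> - 1)\<^sup>2" by simp
    then have "2 * \<bar>x\<bar> \<le> x\<^sup>2 + 1" by (simp add: power2_eq_square algebra_simps)
    then show ?thesis using that by linarith
  qed
  have "K \<subseteq> box"
  proof
    fix \<theta> assume "\<theta> \<in> K"
    then obtain m1 m2 g11 g12 g22 where \<theta>: "\<theta> = (m1, m2, g11, g12, g22)"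
      and g: "0 \<le> g11" "0 \<le> g22" "\<delta> \<le> g11 * g22 - g12 * g12" "g11 + g22 \<le> M"
      and m: "(a1 - m1)\<^sup>2 + (a2 - m2)\<^sup>2 \<le> B"
      by (cases \<theta>) (auto simp: K_def)
    have "g12 * g12 \<le> g11 * g22" using g(3) assms(1) by linarith
    also have "\<dots> \<le> M * M" using g by (intro mult_mono) auto
    finally have "g12\<^sup>2 \<le> M\<^sup>2" by (simp add: power2_eq_square)
    then have "\<bar>g12\<bar> \<le> M" using g by (simp add: abs_le_square_iff[symmetric])
    moreover have "(a1 - m1)\<^sup>2 \<le> B" "(a2 - m2)\<^sup>2 \<le> B"
      using m zero_le_power2[of "a1 - m1"] zero_le_power2[of "a2 - m2"] by linarith+
    then have "\<bar>a1 - m1\<bar> \<le> B + 1" "\<bar>a2 - m2\<bar> \<le> B + 1" using abs_le by blast+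
    ultimately show "\<theta> \<in> box" using g by (auto simp: \<theta> box_def abs_le_iff)
  qed
  moreover have "compact box" unfolding box_def by (intro compact_Times compact_Icc)
  moreover have "closed K"
  proof -
    have "K = {\<theta>. 0 \<le> fst (snd (snd \<theta>))} \<inter> {\<theta>. 0 \<le> snd (snd (snd (snd \<theta>)))}
      \<inter> {\<theta>. \<delta> \<le> fst (snd (snd \<theta>)) * snd (snd (snd (snd \<theta>)))
           - fst (snd (snd (snd \<theta>))) * fst (snd (snd (snd \<theta>)))}
      \<inter> {\<theta>. fst (snd (snd \<theta>)) + snd (snd (snd (snd \<theta>))) \<le> M}
      \<inter> {\<theta>. (a1 - fst \<theta>)\<^sup>2 + (a2 - fst (snd \<theta>))\<^sup>2 \<le> B}"
      unfolding K_def by auto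
    then show ?thesis
      by (simp only:) (intro closed_Int closed_Collect_le continuous_intros)
  qed
  ultimately show ?thesis
    using compact_Int_closed[of box K] by (simp add: Int_absorb1)
qed

lemma loglik_attains_maximum:
  fixes d :: "stat \<Rightarrow> real"
  assumes "d Size_n > 0" "d Size_r > 0" "d Size_s > 0"
    and "cov11 d + cov22 d > 0" "cov11 d * cov22 d - cov12 d * cov12 d > 0"
    and "varZ d > 0" "varW d > 0"
  obtains \<theta> where "\<theta> \<in> param_space" "\<And>\<theta>'. \<theta>' \<in> param_space \<Longrightarrow> loglik ln d \<theta>' \<le> loglik ln d \<theta>"
proof -
  \<comment> \<open>Any point of the parameter space serves to fix the level.\<close>
  define \<theta>0 :: "real param" where "\<theta>0 = (0, 0, 1, 0, 1)"
  have \<theta>0: "\<theta>0 \<in> param_space" by (simp add: \<theta>0_def param_space_iff)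
  obtain \<delta> M B where "\<delta> > 0" and bound:
    "\<And>m1 m2 g11 g12 g22. (m1, m2, g11, g12, g22) \<in> param_space \<Longrightarrow>
       loglik ln d \<theta>0 \<le> loglik ln d (m1, m2, g11, g12, g22) \<Longrightarrow>
       \<delta> \<le> g11 * g22 - g12 * g12 \<and> g11 + g22 \<le> M \<and> (d Mean_Y1 - m1)\<^sup>2 + (d Mean_Y2 - m2)\<^sup>2 \<le> B"
    using loglik_superlevel_bounded[OF assms, of "loglik ln d \<theta>0"] by blast
  define K where "K = {\<theta>::real param. case \<theta> of (m1, m2, g11, g12, g22) \<Rightarrow>
     0 \<le> g11 \<and> 0 \<le> g22 \<and> \<delta> \<le> g11 * g22 - g12 * g12 \<and> g11 + g22 \<le> M
     \<and> (d Mean_Y1 - m1)\<^sup>2 + (d Mean_Y2 - m2)\<^sup>2 \<le> B}"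
  have compact: "compact K" unfolding K_def by (rule compact_parameter_region[OF \<open>\<delta> > 0\<close>])
  have pos: "g11 > 0 \<and> g22 > 0 \<and> g11 * g22 - g12 * g12 > 0"
    if "(m1, m2, g11, g12, g22) \<in> K" for m1 m2 g11 g12 g22
  proof -
    have g: "0 \<le> g11" "0 \<le> g22" "g11 * g22 - g12 * g12 > 0"
      using that \<open>\<delta> > 0\<close> by (auto simp: K_def)
    then have "g11 * g22 > 0" using zero_le_square[of g12] by linarith
    then show ?thesis using g by (auto simp: zero_less_mult_iff)
  qed
  have superlevel: "\<theta> \<in> K" if "\<theta> \<in> param_space" "loglik ln d \<theta>0 \<le> loglik ln d \<theta>" for \<theta>
  proof -
    obtain m1 m2 g11 g12 g22 where \<theta>: "\<theta> = (m1, m2, g11, g12, g22)" by (cases \<theta>)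
    have g: "g11 > 0" "g11 * g22 - g12 * g12 > 0" using that \<theta> by (auto simp: param_space_iff)
    then have "g11 * g22 > 0" using zero_le_square[of g12] by linarith
    then have "g22 > 0" using g(1) by (simp add: zero_less_mult_iff)
    then show ?thesis using g bound[of m1 m2 g11 g12 g22] that by (auto simp: \<theta> K_def)
  qed
  have "continuous_on K (loglik ln d)"
  proof -
    have eq: "loglik ln d = (\<lambda>\<theta>. loglik ln d
        (fst \<theta>, fst (snd \<theta>), fst (snd (snd \<theta>)), fst (snd (snd (snd \<theta>))), snd (snd (snd (snd \<theta>)))))"
      by simp
    show ?thesis
      by (subst eq, unfold loglik_centred, intro continuous_intros) (use pos in fastforce)+
  qed
  then obtain \<theta> where \<theta>: "\<theta> \<in> K" "\<And>\<theta>'. \<theta>' \<in> K \<Longrightarrow> loglik ln d \<theta>' \<le> loglik ln d \<theta>"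
    using continuous_attains_sup[OF compact] superlevel[OF \<theta>0] by blast
  show ?thesis
  proof (rule that)
    show "\<theta> \<in> param_space"
      using \<theta>(1) pos by (cases \<theta>) (auto simp: param_space_iff)
    fix \<theta>' :: "real param" assume "\<theta>' \<in> param_space"
    then show "loglik ln d \<theta>' \<le> loglik ln d \<theta>"
      using \<theta>(2) superlevel[of \<theta>'] \<theta>(2)[OF superlevel[OF \<theta>0]] by fastforce
  qed
qed

lemma DERIV_eventually_max:
  fixes f :: "real \<Rightarrow> real"
  assumes "(f has_field_derivative l) (at x)" "eventually (\<lambda>t. f t \<le> f x) (nhds x)"
  shows "l = 0"
proof -
  obtain e where "e > 0" "\<And>t. dist t x < e \<Longrightarrow> f t \<le> f x"
    using assms(2) unfolding eventually_nhds_metric by blast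
  then show ?thesis
    using DERIV_local_max[OF assms(1) \<open>e > 0\<close>] by (simp add: dist_real_def abs_minus_commute)
qed

text \<open>The parameter space is open, so that each coordinate may be varied a little.\<close>
lemma maximum_is_critical:
  fixes d :: "stat \<Rightarrow> real"
  assumes \<theta>: "(m1, m2, g11, g12, g22) \<in> param_space"
    and max: "\<And>\<theta>'. \<theta>' \<in> param_space \<Longrightarrow> loglik ln d \<theta>' \<le> loglik ln d (m1, m2, g11, g12, g22)"
  shows "score_mu1 d m1 m2 g11 g12 g22 = 0" "score_mu2 d m1 m2 g11 g12 g22 = 0"
    "score_g11 d m1 m2 g11 g12 g22 = 0" "score_g22 d m1 m2 g11 g12 g22 = 0"
    "score_g12 d m1 m2 g11 g12 g22 = 0"
proof -
  have g: "g11 > 0" "g11 * g22 - g12 * g12 > 0" using \<theta> by (auto simp: param_space_iff)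
  then have "g11 * g22 > 0" using zero_le_square[of g12] by linarith
  then have g22: "g22 > 0" using g(1) by (simp add: zero_less_mult_iff)
  have ln: "(ln has_field_derivative 1 / z) (at z)" if "z \<in> {g11, g22, g11 * g22 - g12 * g12}" for z
    using that g g22 DERIV_ln_divide[of z] by auto
  note partials = loglik_partial_derivatives[where lg = ln, OF _ _ _ ln]
  have inside: "eventually (\<lambda>t. h t > 0) (nhds x)" if "h x > 0" "isCont h x" for h :: "real \<Rightarrow> real" and x
    using order_tendstoD(1)[of h "h x" "nhds x" 0] that
    by (simp add: isCont_def tendsto_at_iff_tendsto_nhds)
  show "score_mu1 d m1 m2 g11 g12 g22 = 0"
    by (rule DERIV_eventually_max[OF partials(1)])
       (use g g22 in \<open>auto intro!: max always_eventually simp: param_space_iff simp del: loglik.simps\<close>)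
  show "score_mu2 d m1 m2 g11 g12 g22 = 0"
    by (rule DERIV_eventually_max[OF partials(2)])
       (use g g22 in \<open>auto intro!: max always_eventually simp: param_space_iff simp del: loglik.simps\<close>)
  have "eventually (\<lambda>t. t > 0 \<and> t * g22 - g12 * g12 > 0) (nhds g11)"
    using g by (intro eventually_conj inside) auto
  then show "score_g11 d m1 m2 g11 g12 g22 = 0"
    by (intro DERIV_eventually_max[OF partials(3)])
       (use g g22 in \<open>auto intro!: max elim!: eventually_mono simp: param_space_iff simp del: loglik.simps\<close>)
  have "eventually (\<lambda>t. g11 * t - g12 * g12 > 0) (nhds g22)"
    using g by (intro inside) auto
  then show "score_g22 d m1 m2 g11 g12 g22 = 0"
    by (intro DERIV_eventually_max[OF partials(4)])
       (use g g22 in \<open>auto intro!: max elim!: eventually_mono simp: param_space_iff simp del: loglik.simps\<close>)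
  have "eventually (\<lambda>t. g11 * g22 - t * t > 0) (nhds g12)"
    using g by (intro inside) auto
  then show "score_g12 d m1 m2 g11 g12 g22 = 0"
    by (intro DERIV_eventually_max[OF partials(5)])
       (use g g22 in \<open>auto intro!: max elim!: eventually_mono simp: param_space_iff simp del: loglik.simps\<close>)
qed

lemma complex_stats_data:
  "gap1 (complex_stats d) = of_real (gap1 d)" "gap2 (complex_stats d) = of_real (gap2 d)"
  "cov11 (complex_stats d) = of_real (cov11 d)" "cov12 (complex_stats d) = of_real (cov12 d)"
  "cov22 (complex_stats d) = of_real (cov22 d)"
  "varZ (complex_stats d) = of_real (varZ d)" "varW (complex_stats d) = of_real (varW d)"
  by (simp_all add: complex_stats_def gap1_def gap2_def cov11_def cov12_def cov22_def varZ_def varW_def)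

lemma real_critical_is_score_solution:
  fixes d :: "stat \<Rightarrow> real"
  assumes "g11 \<noteq> 0" "g22 \<noteq> 0" "g11 * g22 - g12 * g12 \<noteq> 0"
    and "score_mu1 d m1 m2 g11 g12 g22 = 0" "score_mu2 d m1 m2 g11 g12 g22 = 0"
    "score_g11 d m1 m2 g11 g12 g22 = 0" "score_g22 d m1 m2 g11 g12 g22 = 0"
    "score_g12 d m1 m2 g11 g12 g22 = 0"
  shows "score_solution (complex_stats d) (complex_param (m1, m2, g11, g12, g22))"
proof -
  have stat: "complex_stats d i = of_real (d i)" for i by (simp add: complex_stats_def)
  have "score_mu1 (complex_stats d) (of_real m1) (of_real m2) (of_real g11) (of_real g12) (of_real g22)
      = of_real (score_mu1 d m1 m2 g11 g12 g22)"
    "score_mu2 (complex_stats d) (of_real m1) (of_real m2) (of_real g11) (of_real g12) (of_real g22)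
      = of_real (score_mu2 d m1 m2 g11 g12 g22)"
    "score_g11 (complex_stats d) (of_real m1) (of_real m2) (of_real g11) (of_real g12) (of_real g22)
      = of_real (score_g11 d m1 m2 g11 g12 g22)"
    "score_g22 (complex_stats d) (of_real m1) (of_real m2) (of_real g11) (of_real g12) (of_real g22)
      = of_real (score_g22 d m1 m2 g11 g12 g22)"
    "score_g12 (complex_stats d) (of_real m1) (of_real m2) (of_real g11) (of_real g12) (of_real g22)
      = of_real (score_g12 d m1 m2 g11 g12 g22)"
    by (simp_all add: score_mu1_def score_mu2_def score_g11_def score_g22_def score_g12_def
        complex_stats_data stat)
  moreover have "complex_of_real g11 * of_real g22 - of_real g12 * of_real g12
      = of_real (g11 * g22 - g12 * g12)" by simp
  then have "complex_of_real g11 * of_real g22 - of_real g12 * of_real g12 \<noteq> 0"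
    using assms(3) by (metis of_real_eq_0_iff)
  ultimately show ?thesis using assms by (simp add: score_solution_iff del: score_solution.simps)
qed

text \<open>By the Cauchy--Schwarz inequality, the sample covariance matrix of real data is positive
  semidefinite; nondegeneracy makes it positive definite, which is what coercivity needs.\<close>
lemma real_sample_maximum:
  assumes d: "d \<in> real_sample_data"
    and nondeg: "cov11 d * cov22 d - (cov12 d)\<^sup>2 \<noteq> 0" "varZ d \<noteq> 0" "varW d \<noteq> 0"
  obtains \<theta> where "score_solution (complex_stats d) (complex_param \<theta>)"
    "local_max_on (loglik ln d) param_space \<theta>"
proof -
  obtain n r s Y Z W where d: "d = sample_stats n r s Y Z W" and pos: "n > 0" "r > 0" "s > 0"
    using d by (auto simp: real_sample_data_def)
  have sizes: "d Size_n > 0" "d Size_r > 0" "d Size_s > 0" using pos by (simp_all add: d)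
  have nonneg: "cov11 d \<ge> 0" "cov22 d \<ge> 0" "varZ d \<ge> 0" "varW d \<ge> 0"
    unfolding cov11_def cov22_def varZ_def varW_def d sample_stats.simps
    using sample_variance_nonneg[OF pos(1), of "\<lambda>j. fst (Y j)"]
      sample_variance_nonneg[OF pos(1), of "\<lambda>j. snd (Y j)"]
      sample_variance_nonneg[OF pos(2), of Z] sample_variance_nonneg[OF pos(3), of W]
    by blast+
  have "(cov12 d)\<^sup>2 \<le> cov11 d * cov22 d"
    unfolding cov11_def cov12_def cov22_def d sample_stats.simps
    by (rule sample_cov_Cauchy_Schwarz[OF pos(1)])
  then have det: "cov11 d * cov22 d - cov12 d * cov12 d > 0"
    using nondeg(1) by (simp add: power2_eq_square)
  then have "cov11 d * cov22 d > 0" using zero_le_square[of "cov12 d"] by linarith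
  then have tr: "cov11 d + cov22 d > 0" using nonneg by (auto simp: zero_less_mult_iff)
  have var: "varZ d > 0" "varW d > 0" using nonneg nondeg by auto
  obtain \<theta> where \<theta>: "\<theta> \<in> param_space"
    and max: "\<And>\<theta>'. \<theta>' \<in> param_space \<Longrightarrow> loglik ln d \<theta>' \<le> loglik ln d \<theta>"
    using loglik_attains_maximum[OF sizes tr det var] by blast
  obtain m1 m2 g11 g12 g22 where \<theta>': "\<theta> = (m1, m2, g11, g12, g22)" by (cases \<theta>)
  have g: "g11 > 0" "g11 * g22 - g12 * g12 > 0" using \<theta> by (auto simp: \<theta>' param_space_iff)
  then have "g22 \<noteq> 0" using zero_le_square[of g12] by auto
  show ?thesis
  proof (rule that)
    show "score_solution (complex_stats d) (complex_param \<theta>)"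
      unfolding \<theta>'
      by (rule real_critical_is_score_solution)
         (use g \<open>g22 \<noteq> 0\<close> maximum_is_critical[OF \<theta>[unfolded \<theta>'] max[unfolded \<theta>']] in auto)
    show "local_max_on (loglik ln d) param_space \<theta>"
      unfolding local_max_on_def using \<theta> max by (auto simp: eventually_at_filter)
  qed
qed

section \<open>The maximum likelihood degree\<close>

theorem theorem2p1:
  shows "\<exists>V :: (stat \<Rightarrow> complex) set. proper_algebraic_subset V \<and>
    (\<forall>d. d \<notin> V \<longrightarrow> card {\<theta>. score_solution d \<theta>} = 9) \<and>
    (\<forall>d \<in> real_sample_data. complex_stats d \<notin> V \<longrightarrow>
       (\<exists>\<theta>. score_solution (complex_stats d) (complex_param \<theta>)) \<and>
       (\<exists>\<theta>. score_solution (complex_stats d) (complex_param \<theta>) \<and>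
            local_max_on (loglik ln d) param_space \<theta>))"
proof -
  obtain \<Psi> :: "(stat \<Rightarrow> complex) \<Rightarrow> complex"
    where poly: "polynomial_fun \<Psi>" and nonzero: "\<Psi> sample_point \<noteq> 0"
      and gen: "\<And>d. \<Psi> d \<noteq> 0 \<Longrightarrow> generic_data d"
      and card: "\<And>d. \<Psi> d \<noteq> 0 \<Longrightarrow> card {k. eliminant d k = 0} = 9"
      and nondeg: "\<And>d. \<Psi> d \<noteq> 0 \<Longrightarrow>
        cov11 d * cov22 d - (cov12 d)\<^sup>2 \<noteq> 0 \<and> varZ d \<noteq> 0 \<and> varW d \<noteq> 0"
    using generic_polynomial by blast
  show ?thesis
  proof (intro exI[of _ "{d. \<Psi> d = 0}"] conjI allI impI ballI)
    show "proper_algebraic_subset {d. \<Psi> d = 0}"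
      unfolding proper_algebraic_subset_def using zero_set_algebraic[OF poly] nonzero by blast
    show "card {\<theta>. score_solution d \<theta>} = 9" if "d \<notin> {d. \<Psi> d = 0}" for d
      using that card[of d] bij_betw_same_card[OF score_solutions_bij_roots[OF gen[of d]]] by simp
    fix d assume d: "d \<in> real_sample_data" "complex_stats d \<notin> {d. \<Psi> d = 0}"
    then have "complex_of_real (cov11 d * cov22 d - (cov12 d)\<^sup>2) \<noteq> 0"
        "complex_of_real (varZ d) \<noteq> 0" "complex_of_real (varW d) \<noteq> 0"
      using nondeg[of "complex_stats d"] by (auto simp: complex_stats_data)
    then have "cov11 d * cov22 d - (cov12 d)\<^sup>2 \<noteq> 0" "varZ d \<noteq> 0" "varW d \<noteq> 0"
      unfolding of_real_eq_0_iff by blast+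
    then obtain \<theta> where "score_solution (complex_stats d) (complex_param \<theta>)"
        "local_max_on (loglik ln d) param_space \<theta>"
      using real_sample_maximum[OF d(1)] by blast
    then show "\<exists>\<theta>. score_solution (complex_stats d) (complex_param \<theta>)"
      "\<exists>\<theta>. score_solution (complex_stats d) (complex_param \<theta>) \<and>
          local_max_on (loglik ln d) param_space \<theta>" by blast+
  qed
qed

end
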